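(* Let $p\in(0,1)$ and let $c_p=c_p(m)$ be the $p$-quantile of the distribution of $(m+1)\ln(Y)-mY-Z$, where $Y\sim\Gamma(m-1,1/m)$ and $Z$ is standard exponential, independent. Define $$C_3=\Big\{(\mu,\sigma)\in(-\infty,\hat\mu]\times(0,\infty):\ (m+1)\ln\Big(\frac{\hat\sigma}{\sigma}\Big)-\frac{n(\hat\mu-\mu)+m\hat\sigma}{\sigma}\ge c_p\Big\},$$ $$g(z)=\frac{[c_p-(m+1)(\ln\hat\sigma-\ln z)]\,z+m\hat\sigma}{n},\quad z>0,$$ $$Z_i=-\frac{m\hat\sigma}{m+1}\Big[W_i\Big(-\frac{m}{m+1}\exp\Big\{\frac{c_p}{m+1}\Big\}\Big)\Big]^{-1},\quad i\in\{-1,0\},$$ and $\sigma^*_x=\frac{n(\hat\mu-x)+m\hat\sigma}{m+1}$ for $x\in\mathbb{R}$. Then $B_3=\bigcup_{\tilde\vartheta\in C_3}\mathrm{graph}\,F_{\tilde\vartheta}$ is a confidence band for $F_\vartheta$ with confidence level at least $1-p$ (i.e. $P_\vartheta(\mathrm{graph}\,F_\vartheta\subseteq B_3)\ge1-p$ for all $\vartheta$), and $$B_3=\{(x,y)\in\mathbb{R}\times[0,1]:\ U_3(x)\le y\le O_3(x)\},$$ where $U_3(x)=F_{(\hat\mu,Z_0)}(x)$ for $x\in\mathbb{R}$ and $$O_3(x)=\begin{cases}F_{(\hat\mu,Z_{-1})}(x),&\sigma^*_x<Z_{-1}\\ F_{(\hat\mu+g(\sigma^*_x),\sigma^*_x)}(x),&Z_{-1}\le\sigma^*_x\le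 Z_0\\ F_{(\hat\mu,Z_0)}(x),&\sigma^*_x>Z_0\end{cases}.$$
   Context: Let $1<m\le n$ be integers and $(R_1,\dots,R_m)\in\mathbb{N}_0^m$ with $\sum_{j=1}^mR_j=n-m$; set $\gamma_j=\sum_{i=j}^m(R_i+1)$. A sample of progressively type-II censored order statistics $X=(X_{1:m:n},\dots,X_{m:m:n})$ from an absolutely continuous cdf $F$ with density $f$ has joint density $\prod_{j=1}^m\gamma_jf(x_j)[1-F(x_j)]^{R_j}$ on $x_1\le\dots\le x_m$. Here $F=F_\vartheta$ belongs to the exponential location-scale family: for $\vartheta=(\mu,\sigma)\in\Theta=\mathbb{R}\times(0,\infty)$, $F_\vartheta(x)=1-\exp\{-(x-\mu)/\sigma\}$ for $x>\mu$ and $F_\vartheta(x)=0$ for $x\le\mu$; $\vartheta$ is unknown and $P_\vartheta$ denotes the underlying probability. The MLEs are $\hat\mu=X_{1:m:n}$ and $\hat\sigma=\frac1m\sum_{j=2}^m\gamma_j(X_{j:m:n}-X_{j-1:m:n})$. $\Gamma(a,b)$ is the gamma distribution with shape $a$ and scale $b$. $W_{-1}$ and $W_0$ are the real branches of the Lambert W-function, i.e. the inverses of $x\mapsto xe^x$ on $x\le-1$ and $x\ge-1$, respectively. $\mathrm{graph}\,F=\{(t,F(t)):t\in\mathbb{R}\}$. A confidence band is a random subset $B$ of $\mathbb{R}^2$ such that $\{\mathrm{graph}\,F_\vartheta\subseteq B\}$ is measurable and the vertical sections $\{y:(t,y)\in B\}$ are a.s. intervals. (The set $C_3$ is a confidence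 region for $\vartheta$ with exact level $1-p$, i.e. $P_\vartheta(\vartheta\in C_3)=1-p$.) *)

theory Defs
  imports "HOL-Probability.Probability"
begin

definition expF :: "real \<Rightarrow> real \<Rightarrow> real \<Rightarrow> real" where
  "expF \<mu> \<sigma> t = (if t > \<mu> then 1 - exp (- (t - \<mu>) / \<sigma>) else 0)"

definition expf :: "real \<Rightarrow> real \<Rightarrow> real \<Rightarrow> real" where
  "expf \<mu> \<sigma> t = (if t > \<mu> then exp (- (t - \<mu>) / \<sigma>) / \<sigma> else 0)"

definition gam :: "nat \<Rightarrow> (nat \<Rightarrow> nat) \<Rightarrow> nat \<Rightarrow> real" where
  "gam m R j = real (\<Sum>i=j..m. R i + 1)"

text \<open>Joint density of progressively type-II censored order statistics; samples are
  functions on the index set {1..m}.\<close>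
definition pc_density :: "nat \<Rightarrow> (nat \<Rightarrow> nat) \<Rightarrow> real \<Rightarrow> real \<Rightarrow> (nat \<Rightarrow> real) \<Rightarrow> real" where
  "pc_density m R \<mu> \<sigma> x =
     (if (\<forall>j\<in>{1..<m}. x j \<le> x (Suc j))
      then (\<Prod>j=1..m. gam m R j * expf \<mu> \<sigma> (x j) * (1 - expF \<mu> \<sigma> (x j)) ^ R j)
      else 0)"

definition pc_measure :: "nat \<Rightarrow> (nat \<Rightarrow> nat) \<Rightarrow> real \<Rightarrow> real \<Rightarrow> (nat \<Rightarrow> real) measure" where
  "pc_measure m R \<mu> \<sigma> =
     density (PiM {1..m} (\<lambda>_. lborel)) (\<lambda>x. ennreal (pc_density m R \<mu> \<sigma> x))"

text \<open>MLEs.\<close>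
definition muhat :: "(nat \<Rightarrow> real) \<Rightarrow> real" where
  "muhat x = x 1"

definition sigmahat :: "nat \<Rightarrow> (nat \<Rightarrow> nat) \<Rightarrow> (nat \<Rightarrow> real) \<Rightarrow> real" where
  "sigmahat m R x = (\<Sum>j=2..m. gam m R j * (x j - x (j - 1))) / real m"

text \<open>Distribution of (m+1) ln Y - m Y - Z with Y ~ Gamma(m-1, scale 1/m) (= Erlang with
  shape m-1 and rate m) and Z ~ Exp(1) independent.\<close>
definition T_dist :: "nat \<Rightarrow> real measure" where
  "T_dist m = distr
     (density lborel (\<lambda>y. ennreal (erlang_density (m - 2) (real m) y))
        \<Otimes>\<^sub>M density lborel (\<lambda>z. ennreal (exponential_density 1 z)))
     lborel (\<lambda>(y, z). real (m + 1) * ln y - real m * y - z)"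

definition cp :: "nat \<Rightarrow> real \<Rightarrow> real" where
  "cp m p = Inf {c. measure (T_dist m) {..c} \<ge> p}"

definition lambertW0 :: "real \<Rightarrow> real" where
  "lambertW0 y = (THE w. w \<ge> -1 \<and> w * exp w = y)"

definition lambertWm1 :: "real \<Rightarrow> real" where
  "lambertWm1 y = (THE w. w \<le> -1 \<and> w * exp w = y)"

definition graph :: "(real \<Rightarrow> real) \<Rightarrow> (real \<times> real) set" where
  "graph F = {(t, F t) | t. True}"

definition C3 :: "nat \<Rightarrow> nat \<Rightarrow> (nat \<Rightarrow> nat) \<Rightarrow> real \<Rightarrow> (nat \<Rightarrow> real) \<Rightarrow> (real \<times> real) set" where
  "C3 n m R p x = {(\<mu>, \<sigma>). \<mu> \<le> muhat x \<and> \<sigma> > 0 \<and>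
      real (m + 1) * ln (sigmahat m R x / \<sigma>)
        - (real n * (muhat x - \<mu>) + real m * sigmahat m R x) / \<sigma> \<ge> cp m p}"

definition B3 :: "nat \<Rightarrow> nat \<Rightarrow> (nat \<Rightarrow> nat) \<Rightarrow> real \<Rightarrow> (nat \<Rightarrow> real) \<Rightarrow> (real \<times> real) set" where
  "B3 n m R p x = (\<Union>(\<mu>, \<sigma>) \<in> C3 n m R p x. graph (expF \<mu> \<sigma>))"

definition gfun :: "nat \<Rightarrow> nat \<Rightarrow> (nat \<Rightarrow> nat) \<Rightarrow> real \<Rightarrow> (nat \<Rightarrow> real) \<Rightarrow> real \<Rightarrow> real" where
  "gfun n m R p x z =
     ((cp m p - real (m + 1) * (ln (sigmahat m R x) - ln z)) * z + real m * sigmahat m R x) / real n"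

definition Z0 :: "nat \<Rightarrow> (nat \<Rightarrow> nat) \<Rightarrow> real \<Rightarrow> (nat \<Rightarrow> real) \<Rightarrow> real" where
  "Z0 m R p x = - (real m * sigmahat m R x / real (m + 1)) *
      inverse (lambertW0 (- (real m / real (m + 1)) * exp (cp m p / real (m + 1))))"

definition Zm1 :: "nat \<Rightarrow> (nat \<Rightarrow> nat) \<Rightarrow> real \<Rightarrow> (nat \<Rightarrow> real) \<Rightarrow> real" where
  "Zm1 m R p x = - (real m * sigmahat m R x / real (m + 1)) *
      inverse (lambertWm1 (- (real m / real (m + 1)) * exp (cp m p / real (m + 1))))"

definition sigstar :: "nat \<Rightarrow> nat \<Rightarrow> (nat \<Rightarrow> nat) \<Rightarrow> (nat \<Rightarrow> real) \<Rightarrow> real \<Rightarrow> real" where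
  "sigstar n m R x t = (real n * (muhat x - t) + real m * sigmahat m R x) / real (m + 1)"

definition U3 :: "nat \<Rightarrow> (nat \<Rightarrow> nat) \<Rightarrow> real \<Rightarrow> (nat \<Rightarrow> real) \<Rightarrow> real \<Rightarrow> real" where
  "U3 m R p x t = expF (muhat x) (Z0 m R p x) t"

definition O3 :: "nat \<Rightarrow> nat \<Rightarrow> (nat \<Rightarrow> nat) \<Rightarrow> real \<Rightarrow> (nat \<Rightarrow> real) \<Rightarrow> real \<Rightarrow> real" where
  "O3 n m R p x t =
     (let s = sigstar n m R x t in
      if s < Zm1 m R p x then expF (muhat x) (Zm1 m R p x) t
      else if s \<le> Z0 m R p x then expF (muhat x + gfun n m R p x s) s t
      else expF (muhat x) (Z0 m R p x) t)"

end

theory Submission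
  imports Defs
begin

text \<open>
  In terms of independent \<open>Z \<sim> Exp(1)\<close> and \<open>Y \<sim> \<Gamma>(m - 1, 1/m)\<close>, the estimators are distributed as
  \<open>\<mu> + \<sigma> Z / n\<close> and \<open>\<sigma> Y\<close>, since the normalized spacings of the sample are independent
  exponentials; hence \<open>C3\<close> covers the true parameter with probability at least \<open>1 - p\<close>, and the band
  inherits this. For \<open>\<sigma>hat > 0\<close> the region is \<open>{(\<mu>, \<sigma>). \<mu>hat + g \<sigma> \<le> \<mu> \<le> \<mu>hat}\<close>, and \<open>g \<le> 0\<close> holds exactly between
  the two Lambert values. At a fixed \<open>t\<close> the distribution function depends monotonically on
  \<open>(t - \<mu>) / \<sigma>\<close>, which is smallest in the corner \<open>(\<mu>hat, Z0)\<close> (if \<open>t > \<mu>hat\<close>) and largest on the lower boundary,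
  at \<open>\<sigma>*\<close> clamped to the admissible interval; intermediate values are attained by continuity.
  The coverage event has to be measurable also on the null set \<open>\<sigma>hat \<le> 0\<close>. For \<open>\<sigma>hat \<noteq> 0\<close> it suffices to test
  rational \<open>t\<close>, and for fixed \<open>t\<close> the event is a countable union of projections of compact
  sets; for \<open>\<sigma>hat = 0\<close> the band covers the graph exactly if the region contains the parameter.
\<close>

section \<open>The Lambert branches and the shape of the band\<close>

lemma xexp_strict_mono:
  fixes x y :: real
  assumes "- 1 \<le> x" "x < y"
  shows "x * exp x < y * exp y"
proof -
  have "((\<lambda>w. w * exp w) has_real_derivative (1 + w) * exp w) (at w)" for w :: real
    by (rule derivative_eq_intros refl | simp add: algebra_simps)+
  moreover have "0 < (1 + w) * exp w" if "x < w" for w :: real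
    using assms that by simp
  ultimately show ?thesis
    by (intro DERIV_pos_imp_increasing_open[OF assms(2)]) (auto intro!: continuous_intros)
qed

lemma xexp_strict_antimono:
  fixes x y :: real
  assumes "y \<le> - 1" "x < y"
  shows "y * exp y < x * exp x"
proof -
  have "((\<lambda>w. w * exp w) has_real_derivative (1 + w) * exp w) (at w)" for w :: real
    by (rule derivative_eq_intros refl | simp add: algebra_simps)+
  moreover have "(1 + w) * exp w < 0" if "w < y" for w :: real
    using assms that by (simp add: mult_neg_pos)
  ultimately show ?thesis
    by (intro DERIV_neg_imp_decreasing_open[OF assms(2)]) (auto intro!: continuous_intros)
qed

text \<open>The inequalities place \<open>y\<close> between the minimum of \<open>w * exp w\<close>
  at -1 and its value at 0. Existence comes from the intermediate value theorem and uniqueness from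
  monotonicity, so the \<open>THE\<close> in the definition denotes. Strict negativity later permits
  inverting the branch.\<close>

lemma lambertW0:
  assumes "- exp (- 1) < y" "y < 0"
  shows "- 1 \<le> lambertW0 y" "lambertW0 y < 0" "lambertW0 y * exp (lambertW0 y) = y"
proof -
  have "\<exists>w\<ge>- 1. w \<le> 0 \<and> w * exp w = y"
    using assms by (intro IVT') (auto intro!: continuous_intros)
  then obtain w where w: "- 1 \<le> w" "w * exp w = y" by blast
  have "lambertW0 y = w"
    unfolding lambertW0_def
  proof (rule the_equality)
    show "v = w" if "- 1 \<le> v \<and> v * exp v = y" for v
      using that w xexp_strict_mono[of v w] xexp_strict_mono[of w v] by (cases v w rule: linorder_cases) auto
  qed (use w in auto)
  moreover have "w < 0"
  proof (rule ccontr)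
    assume "\<not> w < 0"
    then have "0 \<le> w * exp w" by simp
    with w(2) assms(2) show False by linarith
  qed
  ultimately show "- 1 \<le> lambertW0 y" "lambertW0 y < 0" "lambertW0 y * exp (lambertW0 y) = y"
    using w by simp_all
qed

lemma lambertWm1:
  assumes "- exp (- 1) < y" "y < 0"
  shows "lambertWm1 y \<le> - 1" "lambertWm1 y * exp (lambertWm1 y) = y"
proof -
  \<comment> \<open>A left end for the intermediate value theorem is found from the limit of x / exp
    x: for large x the point -x has a value above \<open>y\<close>.\<close>
  have "((\<lambda>x::real. x ^ 1 / exp x) \<longlongrightarrow> 0) at_top" by (rule tendsto_power_div_exp_0)
  then have "eventually (\<lambda>x::real. x ^ 1 / exp x < - y \<and> 1 \<le> x) at_top"
    using assms(2) by (intro eventually_conj order_tendstoD eventually_ge_at_top) auto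
  then obtain x :: real where "x ^ 1 / exp x < - y" "1 \<le> x"
    by (auto simp: eventually_at_top_linorder)
  then obtain l where l: "y < l * exp l" "l \<le> - 1"
    by (intro that[of "- x"]) (auto simp: exp_minus field_simps)
  then have "\<exists>w\<ge>l. w \<le> - 1 \<and> w * exp w = y"
    using assms by (intro IVT2') (auto intro!: continuous_intros)
  then obtain w where w: "w \<le> - 1" "w * exp w = y" by blast
  have "lambertWm1 y = w"
    unfolding lambertWm1_def
  proof (rule the_equality)
    show "v = w" if "v \<le> - 1 \<and> v * exp v = y" for v
      using that w xexp_strict_antimono[of v w] xexp_strict_antimono[of w v] by (cases v w rule: linorder_cases) auto
  qed (use w in auto)
  then show "lambertWm1 y \<le> - 1" "lambertWm1 y * exp (lambertWm1 y) = y" using w by auto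
qed

text \<open>\<open>w * exp w\<close> decreases up to -1 and increases afterwards, so its sublevel
  set is the interval between the two branches. On either side of -1 one of the two bounds is
  automatic.\<close>

lemma xexp_le_iff:
  assumes "- exp (- 1) < y" "y < 0"
  shows "w * exp w \<le> y \<longleftrightarrow> lambertWm1 y \<le> w \<and> w \<le> lambertW0 y"
proof (cases "w \<le> - 1")
  case True
  note W = lambertWm1[OF assms]
  have "w * exp w \<le> lambertWm1 y * exp (lambertWm1 y) \<longleftrightarrow> lambertWm1 y \<le> w"
    using xexp_strict_antimono[OF W(1), of w] xexp_strict_antimono[OF True, of "lambertWm1 y"]
    by (cases w "lambertWm1 y" rule: linorder_cases) auto
  moreover have "w \<le> lambertW0 y" using True lambertW0(1)[OF assms] by simp
  ultimately show ?thesis unfolding W(2) by simp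
next
  case False
  note W = lambertW0[OF assms]
  have "w * exp w \<le> lambertW0 y * exp (lambertW0 y) \<longleftrightarrow> w \<le> lambertW0 y"
    using xexp_strict_mono[OF W(1), of w] xexp_strict_mono[of w "lambertW0 y"] False
    by (cases w "lambertW0 y" rule: linorder_cases) auto
  moreover have "lambertWm1 y \<le> w" using False lambertWm1(1)[OF assms] by simp
  ultimately show ?thesis unfolding W(3) by simp
qed

section \<open>The region and its band for given values of the estimators\<close>

text \<open>This is \<open>C3\<close> with the estimates turned into free parameters:
  \<open>K\<close>, \<open>M\<close>, \<open>N\<close> stand for m + 1, m, n, and \<open>a\<close>,
  \<open>s\<close> for the two estimates. No sign of \<open>s\<close> is fixed, because the coverage
  event has to be studied on the whole plane of estimates.\<close>

definition conf_region :: "real \<Rightarrow> real \<Rightarrow> real \<Rightarrow> real \<Rightarrow> real \<Rightarrow> real \<Rightarrow> (real \<times> real) set" where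
  "conf_region K M N c a s = {(\<mu>, \<sigma>). \<mu> \<le> a \<and> \<sigma> > 0 \<and>
      c \<le> K * ln (s / \<sigma>) - (N * (a - \<mu>) + M * s) / \<sigma>}"

definition conf_band :: "real \<Rightarrow> real \<Rightarrow> real \<Rightarrow> real \<Rightarrow> real \<Rightarrow> real \<Rightarrow> (real \<times> real) set" where
  "conf_band K M N c a s = (\<Union>(\<mu>, \<sigma>) \<in> conf_region K M N c a s. graph (expF \<mu> \<sigma>))"

lemma conf_band_iff:
  "(t, y) \<in> conf_band K M N c a s \<longleftrightarrow> (\<exists>(\<mu>, \<sigma>) \<in> conf_region K M N c a s. y = expF \<mu> \<sigma> t)"
  by (auto simp: conf_band_def graph_def)

text \<open>The clamped form is continuous in both parameters for \<sigma> > 0 and injective in the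
  clamped quotient, so comparing or equating distribution functions reduces to standardized
  values.\<close>

lemma expF_alt: "0 < \<sigma> \<Longrightarrow> expF \<mu> \<sigma> t = 1 - exp (- max 0 ((t - \<mu>) / \<sigma>))"
proof (cases "\<mu> < t")
  case True
  moreover assume "0 < \<sigma>"
  ultimately have "max 0 ((t - \<mu>) / \<sigma>) = (t - \<mu>) / \<sigma>" by (intro max_absorb2) simp
  with True show ?thesis by (simp only: expF_def minus_divide_left if_True)
next
  case False
  moreover assume "0 < \<sigma>"
  ultimately have "max 0 ((t - \<mu>) / \<sigma>) = 0" by (intro max_absorb1 divide_nonpos_pos) auto
  with False show ?thesis by (simp add: expF_def)
qed

lemma expF_mono:
  assumes "0 < \<sigma>" "0 < \<sigma>'" "(t - \<mu>) / \<sigma> \<le> (t - \<mu>') / \<sigma>'"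
  shows "expF \<mu> \<sigma> t \<le> expF \<mu>' \<sigma>' t"
proof -
  have "max 0 ((t - \<mu>) / \<sigma>) \<le> max 0 ((t - \<mu>') / \<sigma>')"
    using assms(3) by (intro max.mono order_refl)
  then show ?thesis unfolding expF_alt[OF assms(1)] expF_alt[OF assms(2)]
    by (intro diff_left_mono) (simp only: exp_le_cancel_iff neg_le_iff_le)
qed

text \<open>K * ln y - M * y has its maximum over y > 0 at y = K / M, with value K * ln (K / M) - K.
  The bound on \<open>c\<close> thus puts the critical value below the supremum of the pivot; it is
  exactly what places \<open>y0\<close> in the domain of both Lambert branches.\<close>

locale exp_conf =
  fixes K M N c a s :: real
  assumes K: "0 < K" and M: "0 < M" and N: "0 < N" and s: "0 < s"
    and c: "c < K * ln (K / M) - K"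
begin

definition "y0 = - (M / K) * exp (c / K)"
definition "L0 = - (M * s / K) * inverse (lambertW0 y0)"
definition "Lm1 = - (M * s / K) * inverse (lambertWm1 y0)"
text \<open>\<open>gf z\<close> is the offset from \<open>a\<close> of the lower boundary of the
  region at scale z, and \<open>star t\<close> is the stationary point of the standardized value (t
  - (a + gf z)) / z along that boundary.\<close>

definition "gf z = ((c - K * (ln s - ln z)) * z + M * s) / N"
definition "star t = (N * (a - t) + M * s) / K"

lemma y0: "- exp (- 1) < y0" "y0 < 0"
proof -
  have "c / K < ln (K / M) + - 1"
    using K c M by (simp add: field_simps)
  then have "exp (c / K) < exp (ln (K / M) + - 1)" by simp
  also have "\<dots> = K / M * exp (- 1)" using K M unfolding exp_add by simp
  finally have "M / K * exp (c / K) < M / K * (K / M * exp (- 1))"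
    using K M by (intro mult_strict_left_mono) auto
  then show "- exp (- 1) < y0" using K M by (simp add: y0_def)
  show "y0 < 0" using K M by (simp add: y0_def)
qed

lemma L_alt: "L0 = M * s / K * inverse (- lambertW0 y0)" "Lm1 = M * s / K * inverse (- lambertWm1 y0)"
  by (simp_all add: L0_def Lm1_def)

lemma L_pos: "0 < L0" "0 < Lm1"
  using lambertW0(2)[OF y0] lambertWm1(1)[OF y0] K M s unfolding L_alt
  by (intro mult_pos_pos; simp)+

text \<open>The section of the region over \<sigma> is nonempty exactly when
  \<open>gf \<sigma>\<close> is at most 0. With w = - M s / (K \<sigma>) this becomes w * exp w
  \<le> y0, solved by the Lambert branches; w increases with \<sigma>, so the order of the end
  points is kept.\<close>

lemma gf_le_0_iff:
  assumes "0 < \<sigma>"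
  shows "gf \<sigma> \<le> 0 \<longleftrightarrow> Lm1 \<le> \<sigma> \<and> \<sigma> \<le> L0"
proof -
  define w where "w = - (M * s / (K * \<sigma>))"
  have w: "w < 0" using K M s assms by (simp add: w_def)
  have "gf \<sigma> \<le> 0 \<longleftrightarrow> (c - K * (ln s - ln \<sigma>)) * \<sigma> + M * s \<le> 0"
    using N by (simp add: gf_def divide_le_0_iff)
  also have "\<dots> \<longleftrightarrow> K * \<sigma> * (c / K - (ln s - ln \<sigma>) - w) \<le> 0"
  proof -
    have "(c - K * (ln s - ln \<sigma>)) * \<sigma> + M * s = K * \<sigma> * (c / K - (ln s - ln \<sigma>) - w)"
      using K assms by (simp add: w_def field_simps)
    then show ?thesis by simp
  qed
  also have "\<dots> \<longleftrightarrow> c / K \<le> ln s - ln \<sigma> + w"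
  proof -
    have "0 < K * \<sigma>" using K assms by simp
    note mult_le_cancel_left_pos[OF this, of _ 0, simplified mult_zero_right]
    then show ?thesis by (simp only:) linarith
  qed
  also have "\<dots> \<longleftrightarrow> exp (c / K) \<le> s / \<sigma> * exp w"
    using s assms by (subst exp_le_cancel_iff[symmetric]) (simp add: exp_add exp_diff)
  also have "\<dots> \<longleftrightarrow> M / K * exp (c / K) \<le> M / K * (s / \<sigma> * exp w)"
    using K M by (intro mult_le_cancel_left_pos[symmetric]) simp
  also have "\<dots> \<longleftrightarrow> w * exp w \<le> y0"
    using K M assms by (simp add: y0_def w_def field_simps)
  also have "\<dots> \<longleftrightarrow> lambertWm1 y0 \<le> w \<and> w \<le> lambertW0 y0"
    by (rule xexp_le_iff[OF y0])
  also have "lambertWm1 y0 \<le> w \<longleftrightarrow> Lm1 \<le> \<sigma>"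
  proof -
    define u where "u = - lambertWm1 y0"
    have "0 < u" using lambertWm1(1)[OF y0] by (simp add: u_def)
    then have "- u \<le> w \<longleftrightarrow> M * s / K * inverse u \<le> \<sigma>"
      using K assms unfolding w_def by (simp add: field_simps)
    then show ?thesis by (simp add: L_alt u_def)
  qed
  also have "w \<le> lambertW0 y0 \<longleftrightarrow> \<sigma> \<le> L0"
  proof -
    define u where "u = - lambertW0 y0"
    have "0 < u" using lambertW0(2)[OF y0] by (simp add: u_def)
    then have "w \<le> - u \<longleftrightarrow> \<sigma> \<le> M * s / K * inverse u"
      using K assms unfolding w_def by (simp add: field_simps)
    then show ?thesis by (simp add: L_alt u_def)
  qed
  finally show ?thesis .
qed

lemma L_le: "Lm1 \<le> L0"
proof -
  have "inverse (- lambertWm1 y0) \<le> inverse (- lambertW0 y0)"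
    using lambertW0(1,2)[OF y0] lambertWm1(1)[OF y0] by (intro le_imp_inverse_le) auto
  then show ?thesis
    using K M s unfolding L_alt by (intro mult_left_mono) auto
qed

text \<open>At the end points the same substitution gives equality, so the lower boundary meets
  \<mu> = a there. This reconciles the outer cases of \<open>O3\<close>, which use the location
  muhat, with the middle one.\<close>

lemma gf_L:
  assumes "\<sigma> = L0 \<or> \<sigma> = Lm1"
  shows "gf \<sigma> = 0"
proof -
  obtain w where w: "w < 0" "w * exp w = y0" "\<sigma> = - (M * s / K) * inverse w"
  proof (cases "\<sigma> = L0")
    case True
    then show ?thesis using that[OF lambertW0(2,3)[OF y0]] by (simp only: L0_def)
  next
    case False
    have "lambertWm1 y0 < 0" using lambertWm1(1)[OF y0] by simp
    then show ?thesis using that[OF _ lambertWm1(2)[OF y0]] False assms by (simp only: Lm1_def) blast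
  qed
  have \<sigma>: "0 < \<sigma>" using assms L_pos by auto
  have wdef: "w = - (M * s / (K * \<sigma>))" using w(1) K M s unfolding w(3) by (simp add: field_simps)
  have "exp (c / K) = s / \<sigma> * exp w"
  proof -
    have "M / K * exp (c / K) = M / K * (s / \<sigma> * exp w)"
      using w(2) M \<sigma> by (simp add: y0_def wdef field_simps)
    then show ?thesis using K M by (subst (asm) mult_cancel_left) simp
  qed
  then have "exp (c / K) = exp (ln s - ln \<sigma> + w)"
    using s \<sigma> by (simp add: exp_add exp_diff)
  then have "c / K = ln s - ln \<sigma> + w" by simp
  then have "c = K * (ln s - ln \<sigma>) + K * w" using K M by (simp add: field_simps)
  then show ?thesis using K M s N \<sigma> by (simp add: gf_def wdef field_simps)
qed

lemma conf_region_iff: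
  "(\<mu>, \<sigma>) \<in> conf_region K M N c a s \<longleftrightarrow> 0 < \<sigma> \<and> a + gf \<sigma> \<le> \<mu> \<and> \<mu> \<le> a"
proof -
  have "c \<le> K * ln (s / \<sigma>) - (N * (a - \<mu>) + M * s) / \<sigma> \<longleftrightarrow> a + gf \<sigma> \<le> \<mu>" if "0 < \<sigma>"
    using that N s unfolding gf_def by (simp add: ln_div field_simps)
  then show ?thesis by (auto simp: conf_region_def)
qed

lemma conf_region_bounds:
  assumes "(\<mu>, \<sigma>) \<in> conf_region K M N c a s"
  shows "0 < \<sigma>" "a + gf \<sigma> \<le> \<mu>" "\<mu> \<le> a" "Lm1 \<le> \<sigma>" "\<sigma> \<le> L0"
proof -
  show *: "0 < \<sigma>" "a + gf \<sigma> \<le> \<mu>" "\<mu> \<le> a" using assms unfolding conf_region_iff by blast+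
  then have "gf \<sigma> \<le> 0" by linarith
  then have "Lm1 \<le> \<sigma> \<and> \<sigma> \<le> L0" using gf_le_0_iff[OF *(1)] by (rule iffD1[rotated])
  then show "Lm1 \<le> \<sigma>" "\<sigma> \<le> L0" by (rule conjunct1, rule conjunct2)
qed

text \<open>The point \<open>star t\<close> clamped to the interval from \<open>Lm1\<close> to
  \<open>L0\<close>, with the case distinction of \<open>O3\<close>.\<close>

definition "opt t = (if star t < Lm1 then Lm1 else if star t \<le> L0 then star t else L0)"

lemma opt_bounds: "0 < opt t" "Lm1 \<le> opt t" "opt t \<le> L0"
  using L_pos L_le by (auto simp: opt_def)

text \<open>The inequality \<open>ln r \<le> r - 1\<close> replaces the discussion of the sign of the derivative.\<close>

lemma opt_max:
  assumes "0 < \<sigma>" "Lm1 \<le> \<sigma>" "\<sigma> \<le> L0"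
  shows "(t - (a + gf \<sigma>)) / \<sigma> \<le> (t - (a + gf (opt t))) / opt t"
proof -
  let ?o = "opt t"
  have o: "0 < ?o" by (rule opt_bounds)
  \<comment> \<open>Up to a constant, the standardized value on the lower boundary is a negative
    multiple of star t / z + ln z, so this function has to be minimized.\<close>
  have rew: "(t - (a + gf z)) / z = - K / N * (star t / z + ln z) + (K * ln s - c) / N"
    if "0 < z" for z
  proof -
    have "K * star t = N * (a - t) + M * s" using K by (simp add: star_def)
    moreover have "N * gf z = (c - K * (ln s - ln z)) * z + M * s" using N by (simp add: gf_def)
    ultimately have "N * (t - (a + gf z)) = - (K * star t) - K * ln z * z + (K * ln s - c) * z"
      by (simp add: algebra_simps)
    then have "N * (t - (a + gf z)) / (N * z) = (- (K * star t) - K * ln z * z + (K * ln s - c) * z) / (N * z)"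
      by (rule arg_cong)
    then show ?thesis using N that by (simp add: add_divide_distrib diff_divide_distrib distrib_left)
  qed
  \<comment> \<open>The variational inequality of a projection: \<sigma> lies in the interval to
    which \<open>star t\<close> is clamped.\<close>
  have "0 \<le> (star t - ?o) * (?o - \<sigma>)"
  proof -
    consider "star t < Lm1" | "Lm1 \<le> star t" "star t \<le> L0" | "Lm1 \<le> star t" "L0 < star t"
      by linarith
    then show ?thesis
    proof cases
      case 1
      then have "?o = Lm1" by (simp add: opt_def)
      with 1 assms(2) show ?thesis by (intro mult_nonpos_nonpos) auto
    next
      case 2
      then have "?o = star t" by (simp add: opt_def)
      then show ?thesis by simp
    next
      case 3
      then have "?o = L0" by (simp add: opt_def)
      with 3 assms(3) show ?thesis by (intro mult_nonneg_nonneg) auto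
    qed
  qed
  then have "0 \<le> (star t - ?o) * (?o - \<sigma>) / (\<sigma> * ?o)"
    using assms(1) o by (intro divide_nonneg_pos mult_pos_pos)
  also have "\<dots> = star t / \<sigma> - star t / ?o - (?o / \<sigma> - 1)"
    using assms(1) o by (simp add: field_simps)
  also have "\<dots> \<le> star t / \<sigma> - star t / ?o - ln (?o / \<sigma>)"
    using assms(1) o by (intro diff_left_mono ln_le_minus_one divide_pos_pos)
  also have "\<dots> = (star t / \<sigma> + ln \<sigma>) - (star t / ?o + ln ?o)"
    using assms(1) o by (simp add: ln_div)
  finally have "star t / ?o + ln ?o \<le> star t / \<sigma> + ln \<sigma>" by simp
  then have "- K / N * (star t / \<sigma> + ln \<sigma>) \<le> - K / N * (star t / ?o + ln ?o)"
    using K M N by (intro mult_left_mono_neg) auto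
  then show ?thesis unfolding rew[OF assms(1)] rew[OF o] by simp
qed

text \<open>From any point of the region, moving \<mu> up to \<open>a\<close> and then \<sigma> up
  to \<open>L0\<close> can only lower the curve at t; moving \<mu> down to the lower boundary and
  then along it to \<open>opt t\<close> can only raise it.\<close>

lemma conf_band_eq:
  "(t, y) \<in> conf_band K M N c a s \<longleftrightarrow> expF a L0 t \<le> y \<and> y \<le> expF (a + gf (opt t)) (opt t) t"
proof
  assume "(t, y) \<in> conf_band K M N c a s"
  then obtain \<mu> \<sigma> where R: "(\<mu>, \<sigma>) \<in> conf_region K M N c a s" and y: "y = expF \<mu> \<sigma> t"
    by (auto simp: conf_band_iff)
  note b = conf_region_bounds[OF R]
  have "expF a L0 t \<le> expF a \<sigma> t"
  proof (cases "a < t")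
    case True
    then show ?thesis using b L_pos by (intro expF_mono divide_left_mono) auto
  qed (simp add: expF_def)
  also have "\<dots> \<le> expF \<mu> \<sigma> t"
    using b by (intro expF_mono divide_right_mono) auto
  finally have 1: "expF a L0 t \<le> expF \<mu> \<sigma> t" .
  have "(t - \<mu>) / \<sigma> \<le> (t - (a + gf \<sigma>)) / \<sigma>"
    using b by (intro divide_right_mono) auto
  also have "\<dots> \<le> (t - (a + gf (opt t))) / opt t" using b by (intro opt_max) auto
  finally have "expF \<mu> \<sigma> t \<le> expF (a + gf (opt t)) (opt t) t"
    using b opt_bounds by (intro expF_mono)
  with 1 y show "expF a L0 t \<le> y \<and> y \<le> expF (a + gf (opt t)) (opt t) t" by simp
next
  assume y: "expF a L0 t \<le> y \<and> y \<le> expF (a + gf (opt t)) (opt t) t"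
  note o = opt_bounds[of t]
  have g: "gf (opt t) \<le> 0" using o gf_le_0_iff by simp
  \<comment> \<open>The two extreme parameters are joined by a path in the region: along \<mu> = a
    from \<open>L0\<close> to \<open>opt t\<close>, then at scale \<open>opt t\<close> down to the
    lower boundary. The case distinction picks the leg on which the value y is attained.\<close>
  show "(t, y) \<in> conf_band K M N c a s"
  proof (cases "y \<le> expF a (opt t) t")
    case True
    have "continuous_on {opt t..L0} (\<lambda>\<sigma>. 1 - exp (- max 0 ((t - a) / \<sigma>)))"
      using o by (intro continuous_intros) auto
    then have "\<exists>\<sigma>\<ge>opt t. \<sigma> \<le> L0 \<and> 1 - exp (- max 0 ((t - a) / \<sigma>)) = y"
      using True y o L_pos by (intro IVT2') (auto simp: expF_alt)
    then obtain \<sigma> where "opt t \<le> \<sigma>" "\<sigma> \<le> L0" "1 - exp (- max 0 ((t - a) / \<sigma>)) = y" by blast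
    then show ?thesis
      using o gf_le_0_iff[of \<sigma>] unfolding conf_band_iff
      by (intro bexI[of _ "(a, \<sigma>)"]) (auto simp: conf_region_iff expF_alt)
  next
    case False
    have "continuous_on {a + gf (opt t)..a} (\<lambda>\<mu>. 1 - exp (- max 0 ((t - \<mu>) / opt t)))"
      using o by (intro continuous_intros) auto
    then have "\<exists>\<mu>\<ge>a + gf (opt t). \<mu> \<le> a \<and> 1 - exp (- max 0 ((t - \<mu>) / opt t)) = y"
      using False y o g by (intro IVT2') (auto simp: expF_alt)
    then obtain \<mu> where "a + gf (opt t) \<le> \<mu>" "\<mu> \<le> a" "1 - exp (- max 0 ((t - \<mu>) / opt t)) = y" by blast
    then show ?thesis
      using o unfolding conf_band_iff
      by (intro bexI[of _ "(\<mu>, opt t)"]) (auto simp: conf_region_iff expF_alt)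
  qed
qed

end

section \<open>The joint law of the estimators\<close>

text \<open>Substitution w = g * (y - b), used for one normalized spacing; the factor
  \<open>g\<close> is the Jacobian.\<close>

lemma nn_integral_scaled_halfline:
  fixes f :: "real \<Rightarrow> ennreal"
  assumes [measurable]: "f \<in> borel_measurable borel" and "0 < g"
  shows "(\<integral>\<^sup>+y. indicator {b..} y * f (g * (y - b)) * ennreal g \<partial>lborel)
    = (\<integral>\<^sup>+w. indicator {0..} w * f w \<partial>lborel)"
proof -
  have "(\<integral>\<^sup>+w. indicator {0..} w * f w \<partial>lborel)
     = ennreal \<bar>g\<bar> * (\<integral>\<^sup>+y. indicator {0..} (- (g * b) + g * y) * f (- (g * b) + g * y) \<partial>lborel)"
    using assms by (intro nn_integral_real_affine) auto
  also have "\<dots> = (\<integral>\<^sup>+y. ennreal g * (indicator {b..} y * f (g * (y - b))) \<partial>lborel)"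
    using assms(2) by (subst nn_integral_cmult[symmetric])
      (auto intro!: nn_integral_cong simp: indicator_def algebra_simps)
  finally show ?thesis by (simp add: mult_ac)
qed

text \<open>Integrates a function of the minimum and the total of the normalized spacings over
  ordered samples, with the \<open>g j\<close> as Jacobian of the normalization. The free parameters
  allow induction on the sample size.\<close>

definition ordered_integral :: "(nat \<Rightarrow> real) \<Rightarrow> nat \<Rightarrow> (real \<times> real \<Rightarrow> ennreal) \<Rightarrow> ennreal" where
  "ordered_integral g k H = (\<integral>\<^sup>+x. indicator {x. \<forall>j\<in>{1..<k}. x j \<le> x (Suc j)} x *
      H (x 1, \<Sum>j=2..k. g j * (x j - x (j - 1))) * (\<Prod>j=2..k. ennreal (g j))
      \<partial>PiM {1..k} (\<lambda>_. lborel))"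

lemma ordered_integral_1:
  assumes [measurable]: "H \<in> borel_measurable borel"
  shows "ordered_integral g 1 H = (\<integral>\<^sup>+a. H (a, 0) \<partial>lborel)"
proof -
  interpret product_sigma_finite "\<lambda>_::nat. lborel :: real measure"
    by standard
  show ?thesis
    unfolding ordered_integral_def
    by (simp add: product_nn_integral_singleton[of "\<lambda>a. H (a, 0)" "Suc 0"])
qed

text \<open>The largest observation occurs only in the last order constraint, the last spacing and
  the last weight. Integrating it out replaces \<open>H\<close> by its integral over all nonnegative
  shifts of the second argument.\<close>

lemma ordered_integral_Suc:
  fixes H :: "real \<times> real \<Rightarrow> ennreal"
  assumes H: "H \<in> borel_measurable borel"
    and "1 \<le> k" and "0 < g (Suc k)"
  shows "ordered_integral g (Suc k) H
    = ordered_integral g k (\<lambda>(a, v). \<integral>\<^sup>+w. indicator {0..} w * H (a, v + w) \<partial>lborel)"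
proof -
  interpret product_sigma_finite "\<lambda>_::nat. lborel :: real measure"
    by standard
  have [measurable]: "H \<in> borel_measurable (borel \<Otimes>\<^sub>M borel)"
    using H by (simp add: borel_prod)
  let ?ord = "\<lambda>x :: nat \<Rightarrow> real. \<forall>j\<in>{1..<Suc k}. x j \<le> x (Suc j)"
  let ?S = "\<lambda>x. \<Sum>j=2..k. g j * (x j - x (j - 1))"
  let ?F = "\<lambda>x::nat \<Rightarrow> real. indicator {x. ?ord x} x *
      H (x 1, \<Sum>j=2..Suc k. g j * (x j - x (j - 1))) * (\<Prod>j=2..Suc k. ennreal (g j))"
  have comp: "(\<lambda>x. x j) \<in> borel_measurable (PiM {1..Suc k} (\<lambda>_. lborel :: real measure))"
    if "j \<in> {1..Suc k}" for j
    using measurable_component_singleton[OF that, of "\<lambda>_. lborel :: real measure"] by simp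
  have F: "?F \<in> borel_measurable (PiM (insert (Suc k) {1..k}) (\<lambda>_. lborel))"
  proof -
    have "{x\<in>space (PiM {1..Suc k} (\<lambda>_. lborel :: real measure)). ?ord x} \<in> sets (PiM {1..Suc k} (\<lambda>_. lborel))"
      by (intro sets.sets_Collect_finite_All borel_measurable_le comp) auto
    then have 1: "(\<lambda>x. indicator {x. ?ord x} x :: ennreal) \<in> borel_measurable (PiM {1..Suc k} (\<lambda>_. lborel))"
      by (subst borel_measurable_indicator_iff) (simp add: Int_def conj_commute)
    have 2: "(\<lambda>x. \<Sum>j=2..Suc k. g j * (x j - x (j - 1))) \<in> borel_measurable (PiM {1..Suc k} (\<lambda>_. lborel))"
      by (intro borel_measurable_sum borel_measurable_times borel_measurable_diff borel_measurable_const comp) auto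
    have "?F \<in> borel_measurable (PiM {1..Suc k} (\<lambda>_. lborel))"
      using 1 2 comp[of 1] by measurable
    moreover have "insert (Suc k) {1..k} = {1..Suc k}" by auto
    ultimately show ?thesis by simp
  qed
  have split: "?F (x(Suc k := y)) = indicator {x. \<forall>j\<in>{1..<k}. x j \<le> x (Suc j)} x *
      (\<Prod>j=2..k. ennreal (g j)) *
      (indicator {x k..} y * H (x 1, ?S x + g (Suc k) * (y - x k)) * ennreal (g (Suc k)))" for x y
  proof -
    have *: "{1..<Suc k} = insert k {1..<k}" using assms(2) by auto
    have ord: "?ord (x(Suc k := y)) \<longleftrightarrow> (\<forall>j\<in>{1..<k}. x j \<le> x (Suc j)) \<and> x k \<le> y"
      unfolding * by auto
    have S: "(\<Sum>j=2..Suc k. g j * ((x(Suc k := y)) j - (x(Suc k := y)) (j - 1)))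
        = ?S x + g (Suc k) * (y - x k)"
      using assms(2) by (auto intro!: sum.cong)
    have P: "(\<Prod>j=2..Suc k. ennreal (g j)) = (\<Prod>j=2..k. ennreal (g j)) * ennreal (g (Suc k))"
      using assms(2) by simp
    have x1: "(x(Suc k := y)) 1 = x 1" using assms(2) by simp
    show ?thesis
      unfolding S P x1 using ord by (auto simp: indicator_def mult_ac)
  qed
  have "ordered_integral g (Suc k) H = (\<integral>\<^sup>+x. ?F x \<partial>PiM (insert (Suc k) {1..k}) (\<lambda>_. lborel))"
    unfolding ordered_integral_def
    by (intro arg_cong2[where f = nn_integral] refl arg_cong2[where f = PiM]) auto
  also have "\<dots> = (\<integral>\<^sup>+x. (\<integral>\<^sup>+y. ?F (x(Suc k := y)) \<partial>lborel) \<partial>PiM {1..k} (\<lambda>_. lborel))"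
    by (intro product_nn_integral_insert F) auto
  also have "\<dots> = (\<integral>\<^sup>+x. indicator {x. \<forall>j\<in>{1..<k}. x j \<le> x (Suc j)} x * (\<Prod>j=2..k. ennreal (g j)) *
        (\<integral>\<^sup>+y. indicator {x k..} y * H (x 1, ?S x + g (Suc k) * (y - x k)) * ennreal (g (Suc k)) \<partial>lborel)
        \<partial>PiM {1..k} (\<lambda>_. lborel))"
    unfolding split by (intro nn_integral_cong nn_integral_cmult) measurable
  also have "\<dots> = (\<integral>\<^sup>+x. indicator {x. \<forall>j\<in>{1..<k}. x j \<le> x (Suc j)} x * (\<Prod>j=2..k. ennreal (g j)) *
        (\<integral>\<^sup>+w. indicator {0..} w * H (x 1, ?S x + w) \<partial>lborel)
        \<partial>PiM {1..k} (\<lambda>_. lborel))"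
    using assms(3)
    by (intro nn_integral_cong arg_cong2[where f = "(*)"] refl
        nn_integral_scaled_halfline[of "\<lambda>w. H (_, _ + w)"]) measurable
  finally show ?thesis
    unfolding ordered_integral_def by (simp add: mult_ac)
qed

text \<open>v ^ k / fact k is the density of the (k + 1)-fold convolution of Lebesgue measure on the
  half-line; this is the step from k to k + 1.\<close>

lemma nn_integral_power_Icc:
  fixes u :: real
  shows "(\<integral>\<^sup>+v. ennreal (v ^ k / fact k) * indicator {0..u} v \<partial>lborel)
    = ennreal (u ^ Suc k / fact (Suc k)) * indicator {0..} u"
proof (cases "0 \<le> u")
  case True
  have "((\<lambda>v. v ^ Suc k / fact (Suc k)) has_real_derivative v ^ k / fact k) (at v)" for v :: real
    by (rule derivative_eq_intros refl | simp)+
  then have "(\<integral>\<^sup>+v. ennreal (v ^ k / fact k) * indicator {0..u} v \<partial>lborel)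
    = u ^ Suc k / fact (Suc k) - 0 ^ Suc k / fact (Suc k)"
    using True by (intro nn_integral_FTC_Icc) auto
  with True show ?thesis by simp
next
  case False
  then show ?thesis by simp
qed

lemma borel_measurable_halfline_convolution:
  fixes H :: "real \<times> real \<Rightarrow> ennreal"
  assumes "H \<in> borel_measurable borel"
  shows "(\<lambda>(a, v). \<integral>\<^sup>+w. indicator {0..} w * H (a, v + w) \<partial>lborel) \<in> borel_measurable borel"
proof -
  have [measurable]: "H \<in> borel_measurable (borel \<Otimes>\<^sub>M borel)"
    using assms by (simp add: borel_prod)
  have "(\<lambda>(a, v). \<integral>\<^sup>+w. indicator {0..} w * H (a, v + w) \<partial>lborel) \<in> borel_measurable (borel \<Otimes>\<^sub>M borel)"
    by measurable
  then show ?thesis by (simp add: borel_prod)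
qed

text \<open>k + 2 observations have k + 1 spacings, which explains the exponent k. Each induction
  step peels off one observation and changes \<open>H\<close>, hence the generalization over
  \<open>H\<close>.\<close>

lemma ordered_integral_eq:
  fixes H :: "real \<times> real \<Rightarrow> ennreal"
  assumes "H \<in> borel_measurable borel" and "\<And>j. j \<in> {2..k + 2} \<Longrightarrow> 0 < g j"
  shows "ordered_integral g (k + 2) H
    = (\<integral>\<^sup>+a. \<integral>\<^sup>+v. H (a, v) * (ennreal (v ^ k / fact k) * indicator {0..} v) \<partial>lborel \<partial>lborel)"
  using assms
proof (induction k arbitrary: H)
  case 0
  have "ordered_integral g (0 + 2) H
    = ordered_integral g 1 (\<lambda>(a, v). \<integral>\<^sup>+w. indicator {0..} w * H (a, v + w) \<partial>lborel)"
    using ordered_integral_Suc[of H 1 g] 0 by (simp add: numeral_2_eq_2)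
  also have "\<dots> = (\<integral>\<^sup>+a. \<integral>\<^sup>+w. indicator {0..} w * H (a, 0 + w) \<partial>lborel \<partial>lborel)"
    by (subst ordered_integral_1) (use borel_measurable_halfline_convolution[OF 0(1)] in auto)
  finally show ?case by (simp add: mult_ac)
next
  case (Suc k)
  have [measurable]: "H \<in> borel_measurable (borel \<Otimes>\<^sub>M borel)"
    using Suc.prems(1) by (simp add: borel_prod)
  let ?H = "\<lambda>(a, v). \<integral>\<^sup>+w. indicator {0..} w * H (a, v + w) \<partial>lborel"
  have "ordered_integral g (Suc k + 2) H = ordered_integral g (k + 2) ?H"
    using ordered_integral_Suc[of H "k + 2" g] Suc.prems by simp
  also have "\<dots> = (\<integral>\<^sup>+a. \<integral>\<^sup>+v. ?H (a, v) * (ennreal (v ^ k / fact k) * indicator {0..} v) \<partial>lborel \<partial>lborel)"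
    using Suc.prems borel_measurable_halfline_convolution[OF Suc.prems(1)] by (intro Suc.IH) auto
  also have "\<dots> = (\<integral>\<^sup>+a. \<integral>\<^sup>+v. H (a, v) * (ennreal (v ^ Suc k / fact (Suc k)) * indicator {0..} v) \<partial>lborel \<partial>lborel)"
  proof (rule nn_integral_cong)
    fix a :: real
    have "(\<integral>\<^sup>+v. ?H (a, v) * (ennreal (v ^ k / fact k) * indicator {0..} v) \<partial>lborel)
      = (\<integral>\<^sup>+v. (\<integral>\<^sup>+u. indicator {v..} u * H (a, u) \<partial>lborel) * (ennreal (v ^ k / fact k) * indicator {0..} v) \<partial>lborel)"
    proof (intro nn_integral_cong arg_cong2[where f = "(*)"] refl)
      fix v :: real
      show "?H (a, v) = (\<integral>\<^sup>+u. indicator {v..} u * H (a, u) \<partial>lborel)"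
        using nn_integral_scaled_halfline[of "\<lambda>w. H (a, v + w)" 1 v] by simp
    qed
    also have "\<dots> = (\<integral>\<^sup>+v. \<integral>\<^sup>+u. H (a, u) * (ennreal (v ^ k / fact k) * indicator {0..u} v) \<partial>lborel \<partial>lborel)"
      by (subst nn_integral_multc[symmetric], measurable)
        (intro nn_integral_cong, auto simp: indicator_def)
    also have "\<dots> = (\<integral>\<^sup>+u. \<integral>\<^sup>+v. H (a, u) * (ennreal (v ^ k / fact k) * indicator {0..u} v) \<partial>lborel \<partial>lborel)"
      \<comment> \<open>The order of integration is exchanged over the triangle 0 \<le> v \<le> u,
        so that the inner integral is that of a power.\<close>
      by (rule lborel_pair.Fubini') (simp add: indicator_def cong: measurable_cong)
    also have "\<dots> = (\<integral>\<^sup>+u. H (a, u) * (ennreal (u ^ Suc k / fact (Suc k)) * indicator {0..} u) \<partial>lborel)"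
      by (subst nn_integral_cmult, measurable) (simp only: nn_integral_power_Icc)
    finally show "(\<integral>\<^sup>+v. ?H (a, v) * (ennreal (v ^ k / fact k) * indicator {0..} v) \<partial>lborel)
      = (\<integral>\<^sup>+v. H (a, v) * (ennreal (v ^ Suc k / fact (Suc k)) * indicator {0..} v) \<partial>lborel)" .
  qed
  finally show ?case .
qed

section \<open>Density of the sample in terms of the estimators\<close>

text \<open>Summation by parts. It turns the exponent of the joint density into a combination of the
  minimum and the spacings with the weights \<open>gam\<close>.\<close>

lemma sum_Abel:
  fixes r y :: "nat \<Rightarrow> real"
  assumes "1 \<le> m"
  shows "(\<Sum>j=1..m. r j * y j)
    = (\<Sum>i=1..m. r i) * y 1 + (\<Sum>j=2..m. (\<Sum>i=j..m. r i) * (y j - y (j - 1)))"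
  using assms
proof (induction m rule: nat_induct_at_least)
  case base
  then show ?case by simp
next
  case (Suc m)
  have tele: "(\<Sum>j=2..Suc m. y j - y (j - 1)) = y (Suc m) - y 1"
    using sum_telescope''[of 1 "Suc m" y] Suc(1)
    by (simp add: numeral_2_eq_2)
  have "(\<Sum>j=2..Suc m. (\<Sum>i=j..Suc m. r i) * (y j - y (j - 1)))
    = (\<Sum>j=2..Suc m. (\<Sum>i=j..m. r i) * (y j - y (j - 1))) + r (Suc m) * (\<Sum>j=2..Suc m. y j - y (j - 1))"
    unfolding sum_distrib_left sum.distrib[symmetric]
    by (intro sum.cong refl) (simp add: algebra_simps)
  also have "(\<Sum>j=2..Suc m. (\<Sum>i=j..m. r i) * (y j - y (j - 1)))
     = (\<Sum>j=2..m. (\<Sum>i=j..m. r i) * (y j - y (j - 1)))"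
    using Suc(1) by simp
  finally have "(\<Sum>j=2..Suc m. (\<Sum>i=j..Suc m. r i) * (y j - y (j - 1)))
    = (\<Sum>j=2..m. (\<Sum>i=j..m. r i) * (y j - y (j - 1))) + r (Suc m) * (y (Suc m) - y 1)"
    unfolding tele .
  then show ?case
    using Suc by (simp only: sum.cl_ivl_Suc) (simp add: algebra_simps)
qed

lemma gam_pos: "j \<le> m \<Longrightarrow> 0 < gam m R j"
  unfolding gam_def of_nat_0_less_iff by (rule sum_pos) auto

text \<open>The factors collapse to exponentials, and after summation by parts the sample enters
  only through the estimators and the order constraint. If x 1 is at most \<mu>, the factor for j =
  1 vanishes.\<close>

lemma pc_density_eq:
  assumes "1 < m" and "0 < \<sigma>"
  shows "pc_density m R \<mu> \<sigma> x = (if (\<forall>j\<in>{1..<m}. x j \<le> x (Suc j)) \<and> \<mu> < x 1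
    then (\<Prod>j=1..m. gam m R j) * exp (- (gam m R 1 * (x 1 - \<mu>) + real m * sigmahat m R x) / \<sigma>) / \<sigma> ^ m
    else 0)"
proof (cases "(\<forall>j\<in>{1..<m}. x j \<le> x (Suc j)) \<and> \<mu> < x 1")
  case True
  have gt: "\<mu> < x j" if "j \<in> {1..m}" for j
  proof -
    from that have "1 \<le> j" "j \<le> m" by auto
    then have "x 1 \<le> x j"
    proof (induction j rule: nat_induct_at_least)
      case (Suc j)
      then have "x j \<le> x (Suc j)" using True by auto
      with Suc show ?case by auto
    qed simp
    with True show ?thesis by auto
  qed
  have "pc_density m R \<mu> \<sigma> x
    = (\<Prod>j=1..m. gam m R j * (exp (- (real (R j + 1) * (x j - \<mu>) / \<sigma>)) / \<sigma>))"
    unfolding pc_density_def using True gt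
    by (auto simp: expf_def expF_def exp_of_nat_mult[symmetric] exp_add[symmetric]
        algebra_simps add_divide_distrib diff_divide_distrib intro!: prod.cong)
  also have "\<dots> = (\<Prod>j=1..m. gam m R j) * exp (- (\<Sum>j=1..m. real (R j + 1) * (x j - \<mu>)) / \<sigma>) / \<sigma> ^ m"
    by (simp only: prod.distrib prod_dividef exp_sum[symmetric] finite_atLeastAtMost sum_negf
        sum_divide_distrib[symmetric] prod_constant card_atLeastAtMost minus_divide_left)
      simp
  also have "(\<Sum>j=1..m. real (R j + 1) * (x j - \<mu>)) = gam m R 1 * (x 1 - \<mu>) + real m * sigmahat m R x"
    using assms(1) sum_Abel[of m "\<lambda>j. real (R j + 1)" "\<lambda>j. x j - \<mu>"]
    by (simp only: gam_def sigmahat_def of_nat_sum) simp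
  finally show ?thesis using True by simp
next
  case False
  then show ?thesis
    using assms(1) by (auto simp: pc_density_def expf_def intro!: prod_zero bexI[of _ 1])
qed

lemma measurable_PiM_component_lborel:
  "j \<in> I \<Longrightarrow> (\<lambda>x. x j) \<in> borel_measurable (PiM I (\<lambda>_. lborel :: real measure))"
  using measurable_component_singleton[of j I "\<lambda>_. lborel :: real measure"] by simp

lemma sigmahat_measurable:
  "sigmahat m R \<in> borel_measurable (PiM {1..m} (\<lambda>_. lborel))"
  unfolding sigmahat_def[abs_def]
  by (intro borel_measurable_divide borel_measurable_sum borel_measurable_times borel_measurable_diff
      borel_measurable_const measurable_PiM_component_lborel) auto

lemma pc_density_measurable:
  assumes "1 < m" and "0 < \<sigma>"
  shows "pc_density m R \<mu> \<sigma> \<in> borel_measurable (PiM {1..m} (\<lambda>_. lborel))"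
proof -
  have x1[measurable]: "(\<lambda>x. x (1::nat)) \<in> borel_measurable (PiM {1..m} (\<lambda>_. lborel :: real measure))"
    using assms by (intro measurable_PiM_component_lborel) auto
  note sigmahat_measurable[measurable]
  have [measurable]: "Measurable.pred (PiM {1..m} (\<lambda>_. lborel))
      (\<lambda>x :: nat \<Rightarrow> real. (\<forall>j\<in>{1..<m}. x j \<le> x (Suc j)))"
    unfolding pred_def
    by (intro sets.sets_Collect_finite_All borel_measurable_le measurable_PiM_component_lborel) auto
  show ?thesis
    unfolding pc_density_eq[OF assms, abs_def] by measurable
qed

text \<open>In law, the estimators are \<mu> + \<sigma> Z / \<open>gam m R 1\<close> and \<sigma> Y
  with Z exponential and Y Erlang, independent. The sample is integrated out by
  \<open>ordered_integral_eq\<close>, and both remaining variables are rescaled affinely.\<close>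

lemma pc_measure_law:
  fixes h :: "real \<times> real \<Rightarrow> ennreal"
  assumes m: "1 < m" and \<sigma>: "0 < \<sigma>" and h: "h \<in> borel_measurable borel"
  shows "(\<integral>\<^sup>+x. h (x 1, sigmahat m R x) \<partial>pc_measure m R \<mu> \<sigma>)
    = (\<integral>\<^sup>+z. \<integral>\<^sup>+y. h (\<mu> + \<sigma> / gam m R 1 * z, \<sigma> * y) * ennreal (erlang_density (m - 2) m y) *
         ennreal (exponential_density 1 z) \<partial>lborel \<partial>lborel)"
proof -
  define k where "k = m - 2"
  have mk: "m = k + 2" using m by (simp add: k_def)
  define n where "n = gam m R 1"
  have n: "0 < n" unfolding n_def using m by (intro gam_pos) auto
  \<comment> \<open>\<open>H\<close> collects \<open>h\<close> and the density except for the
    weights from 2 to m, which belong to \<open>ordered_integral\<close>. Its second argument is the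
    total of the spacings, m times the scale estimate.\<close>
  define H where "H = (\<lambda>(a, v). h (a, v / real m) *
     ennreal (if \<mu> < a then n * exp (- (n * (a - \<mu>) + v) / \<sigma>) / \<sigma> ^ m else 0))"
  have [measurable]: "h \<in> borel_measurable (borel \<Otimes>\<^sub>M borel)"
    using h by (simp add: borel_prod)
  have [measurable]: "H \<in> borel_measurable (borel \<Otimes>\<^sub>M borel)"
    unfolding H_def by measurable
  have [measurable]: "(\<lambda>x. x 1) \<in> borel_measurable (PiM {1..m} (\<lambda>_. lborel :: real measure))"
    using m by (intro measurable_PiM_component_lborel) auto
  note sigmahat_measurable[measurable] pc_density_measurable[OF m \<sigma>, measurable]
  have "(\<integral>\<^sup>+x. h (x 1, sigmahat m R x) \<partial>pc_measure m R \<mu> \<sigma>)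
    = (\<integral>\<^sup>+x. ennreal (pc_density m R \<mu> \<sigma> x) * h (x 1, sigmahat m R x) \<partial>PiM {1..m} (\<lambda>_. lborel))"
    unfolding pc_measure_def by (intro nn_integral_density) measurable
  also have "\<dots> = ordered_integral (gam m R) m H"
    unfolding ordered_integral_def
  proof (intro nn_integral_cong)
    fix x :: "nat \<Rightarrow> real"
    have S: "(\<Sum>j=2..m. gam m R j * (x j - x (j - 1))) = real m * sigmahat m R x"
      using m by (simp add: sigmahat_def)
    have "{1..m} = insert 1 {2..m}" using m by auto
    then have P: "(\<Prod>j=1..m. gam m R j) = n * (\<Prod>j=2..m. gam m R j)"
      by (simp add: n_def)
    have P': "(\<Prod>j=2..m. ennreal (gam m R j)) = ennreal (\<Prod>j=2..m. gam m R j)"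
      by (intro prod_ennreal) (simp add: gam_pos less_imp_le)
    have P0: "0 \<le> (\<Prod>j=2..m. gam m R j)"
      by (intro prod_nonneg) (simp add: gam_pos less_imp_le)
    show "ennreal (pc_density m R \<mu> \<sigma> x) * h (x 1, sigmahat m R x) =
      indicator {x. \<forall>j\<in>{1..<m}. x j \<le> x (Suc j)} x *
      H (x 1, \<Sum>j=2..m. gam m R j * (x j - x (j - 1))) * (\<Prod>j=2..m. ennreal (gam m R j))"
      unfolding S pc_density_eq[OF m \<sigma>] H_def P P' n_def[symmetric] using m n \<sigma> P0
      by (simp add: indicator_def ennreal_mult[symmetric] mult_ac)
  qed
  also have "\<dots> = (\<integral>\<^sup>+a. \<integral>\<^sup>+v. H (a, v) * (ennreal (v ^ k / fact k) * indicator {0..} v) \<partial>lborel \<partial>lborel)"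
  proof -
    have "H \<in> borel_measurable borel"
      using \<open>H \<in> borel_measurable (borel \<Otimes>\<^sub>M borel)\<close> by (simp only: borel_prod)
    then show ?thesis unfolding mk by (intro ordered_integral_eq gam_pos) auto
  qed
  also have "\<dots> = (\<integral>\<^sup>+a. ennreal (\<sigma> * m) *
      (\<integral>\<^sup>+y. H (a, \<sigma> * m * y) * (ennreal ((\<sigma> * m * y) ^ k / fact k) * indicator {0..} y) \<partial>lborel) \<partial>lborel)"
  proof (rule nn_integral_cong)
    fix a :: real
    show "(\<integral>\<^sup>+v. H (a, v) * (ennreal (v ^ k / fact k) * indicator {0..} v) \<partial>lborel) = ennreal (\<sigma> * m) *
      (\<integral>\<^sup>+y. H (a, \<sigma> * m * y) * (ennreal ((\<sigma> * m * y) ^ k / fact k) * indicator {0..} y) \<partial>lborel)"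
      using m \<sigma>
      by (subst nn_integral_real_affine[where c = "\<sigma> * m" and t = 0])
        (auto simp: indicator_def zero_le_mult_iff abs_mult mult_le_0_iff)
  qed
  also have "\<dots> = ennreal (\<sigma> / n) * (\<integral>\<^sup>+z. ennreal (\<sigma> * m) *
      (\<integral>\<^sup>+y. H (\<mu> + \<sigma> / n * z, \<sigma> * m * y) * (ennreal ((\<sigma> * m * y) ^ k / fact k) * indicator {0..} y) \<partial>lborel) \<partial>lborel)"
    using n \<sigma> by (subst nn_integral_real_affine[where c = "\<sigma> / n" and t = \<mu>]) auto
  also have "\<dots> = (\<integral>\<^sup>+z. \<integral>\<^sup>+y. ennreal (\<sigma> / n) * (ennreal (\<sigma> * m) *
      (H (\<mu> + \<sigma> / n * z, \<sigma> * m * y) * (ennreal ((\<sigma> * m * y) ^ k / fact k) * indicator {0..} y))) \<partial>lborel \<partial>lborel)"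
    by (simp add: nn_integral_cmult)
  also have "\<dots> = (\<integral>\<^sup>+z. \<integral>\<^sup>+y. h (\<mu> + \<sigma> / n * z, \<sigma> * y) * ennreal (erlang_density (m - 2) m y) *
         ennreal (exponential_density 1 z) \<partial>lborel \<partial>lborel)"
  proof (rule nn_integral_cong_AE)
    \<comment> \<open>At z = 0 the sample density vanishes while \<open>exponential_density\<close>
      is 1, so this null set is removed.\<close>
    have "AE z in lborel. z \<noteq> (0 :: real)" by (rule AE_lborel_singleton)
    then show "AE z in lborel. (\<integral>\<^sup>+y. ennreal (\<sigma> / n) * (ennreal (\<sigma> * m) *
      (H (\<mu> + \<sigma> / n * z, \<sigma> * m * y) * (ennreal ((\<sigma> * m * y) ^ k / fact k) * indicator {0..} y))) \<partial>lborel)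
      = (\<integral>\<^sup>+y. h (\<mu> + \<sigma> / n * z, \<sigma> * y) * ennreal (erlang_density (m - 2) m y) *
         ennreal (exponential_density 1 z) \<partial>lborel)"
    proof (eventually_elim, intro nn_integral_cong)
      fix z y :: real assume "z \<noteq> 0"
      show "ennreal (\<sigma> / n) * (ennreal (\<sigma> * m) *
        (H (\<mu> + \<sigma> / n * z, \<sigma> * m * y) * (ennreal ((\<sigma> * m * y) ^ k / fact k) * indicator {0..} y)))
        = h (\<mu> + \<sigma> / n * z, \<sigma> * y) * ennreal (erlang_density (m - 2) m y) * ennreal (exponential_density 1 z)"
      proof (cases "0 < z \<and> 0 \<le> y")
        case True
        have "\<mu> < \<mu> + \<sigma> / n * z" using True n \<sigma> by simp
        moreover have "- (n * (\<mu> + \<sigma> / n * z - \<mu>) + \<sigma> * m * y) / \<sigma> = - z + - m * y"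
          using n \<sigma> by (simp add: field_simps)
        ultimately have "H (\<mu> + \<sigma> / n * z, \<sigma> * m * y)
            = h (\<mu> + \<sigma> / n * z, \<sigma> * y) * ennreal (n * (exp (- z) * exp (- m * y)) / \<sigma> ^ m)"
          unfolding H_def using m by (simp add: exp_add[symmetric])
        then have "ennreal (\<sigma> / n) * (ennreal (\<sigma> * m) *
        (H (\<mu> + \<sigma> / n * z, \<sigma> * m * y) * (ennreal ((\<sigma> * m * y) ^ k / fact k) * indicator {0..} y)))
          = h (\<mu> + \<sigma> / n * z, \<sigma> * y) * (ennreal (\<sigma> / n) * ennreal (\<sigma> * m) *
              ennreal (n * (exp (- z) * exp (- m * y)) / \<sigma> ^ m) * ennreal ((\<sigma> * m * y) ^ k / fact k))"
          using True by (simp add: mult_ac)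
        also have "ennreal (\<sigma> / n) * ennreal (\<sigma> * m) *
              ennreal (n * (exp (- z) * exp (- m * y)) / \<sigma> ^ m) * ennreal ((\<sigma> * m * y) ^ k / fact k)
            = ennreal (\<sigma> / n * (\<sigma> * m) * (n * (exp (- z) * exp (- m * y)) / \<sigma> ^ m) * ((\<sigma> * m * y) ^ k / fact k))"
        proof -
          have "ennreal p * ennreal q * ennreal r * ennreal s = ennreal (p * q * r * s)"
            if "0 \<le> p" "0 \<le> q" "0 \<le> r" "0 \<le> s" for p q r s
            using that by (simp add: ennreal_mult)
          then show ?thesis using True n \<sigma> by simp
        qed
        also have "\<sigma> / n * (\<sigma> * m) * (n * (exp (- z) * exp (- m * y)) / \<sigma> ^ m) * ((\<sigma> * m * y) ^ k / fact k)
            = erlang_density (m - 2) m y * exponential_density 1 z"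
        proof -
          \<comment> \<open>Of the m powers of \<sigma> in the density, two cancel against the
            Jacobians and k against the power of the total.\<close>
          have "\<sigma> ^ m = \<sigma> * \<sigma> * \<sigma> ^ k" "m - 2 = k" by (simp_all add: mk)
          then show ?thesis
            using True n \<sigma> m
            by (simp add: erlang_density_def exponential_density_def power_mult_distrib)
        qed
        also have "ennreal \<dots> = ennreal (erlang_density (m - 2) m y) * ennreal (exponential_density 1 z)"
          by (intro ennreal_mult) simp_all
        finally show ?thesis by (simp add: mult_ac)
      next
        case False
        then have "z < 0 \<or> y < 0" using \<open>z \<noteq> 0\<close> by auto
        then show ?thesis
        proof
          assume "z < 0"
          then have "\<sigma> / n * z < 0" using n \<sigma> by (intro mult_pos_neg) simp_all
          with \<open>z < 0\<close> show ?thesis by (simp add: H_def exponential_density_def)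
        qed (simp add: erlang_density_def)
      qed
    qed
  qed
  finally show ?thesis unfolding n_def .
qed

section \<open>The quantile\<close>

text \<open>Below the infimum q the distribution function stays under p, so its left limit, the mass
  strictly below q, is at most p. If all mass lies below \<open>K\<close>, the left limit at
  \<open>K\<close> is 1 > p, so some c < K already bounds q; this makes the second inequality
  strict.\<close>

lemma (in real_distribution) measure_atLeast_quantile:
  assumes p: "0 < p" "p < 1"
  defines "q \<equiv> Inf {c. p \<le> measure M {..c}}"
  shows "1 - p \<le> measure M {q..}"
    and "(AE x in M. x < K) \<Longrightarrow> q < K"
proof -
  \<comment> \<open>The limit 0 at minus infinity bounds the set from below, which gives the real
    \<open>Inf\<close> its meaning.\<close>
  have "eventually (\<lambda>c. cdf M c < p) at_bot"
    using cdf_lim_at_bot p by (intro order_tendstoD)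
  then obtain b where b: "\<And>c. c \<le> b \<Longrightarrow> cdf M c < p"
    unfolding eventually_at_bot_linorder by auto
  have bdd: "bdd_below {c. p \<le> measure M {..c}}"
    by (rule bdd_belowI[of _ b]) (metis b cdf_def linorder_le_cases mem_Collect_eq not_le)
  have less: "cdf M c < p" if "c < q" for c
    using cInf_lower[OF _ bdd, of c] that unfolding q_def cdf_def by force
  have "measure M {..<q} \<le> p"
  proof (rule tendsto_upperbound[OF cdf_at_left])
    show "eventually (\<lambda>c. cdf M c \<le> p) (at_left q)"
      using less by (auto simp: eventually_at_filter intro!: always_eventually less_imp_le)
  qed simp
  moreover have "measure M {q..} = 1 - measure M {..<q}"
    using prob_compl[of "{..<q}"] by (simp add: Compl_eq_Diff_UNIV[symmetric] Compl_lessThan)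
  ultimately show "1 - p \<le> measure M {q..}" by simp
  assume "AE x in M. x < K"
  then have "measure M {..<K} = 1"
    using prob_eq_1[of "{..<K}"] by simp
  then have "eventually (\<lambda>c. p < cdf M c) (at_left K)"
    using cdf_at_left[of K] p by (intro order_tendstoD) auto
  then have "eventually (\<lambda>c. p < cdf M c \<and> c < K) (at_left K)"
    by (auto simp: eventually_at_filter elim: eventually_mono)
  then obtain c where "p < cdf M c" "c < K"
    using eventually_happens by fastforce
  then have "q \<le> c" unfolding q_def by (intro cInf_lower bdd) (simp add: cdf_def)
  with \<open>c < K\<close> show "q < K" by simp
qed

section \<open>Distribution of the pivot\<close>

abbreviation gamma_exp_pair :: "nat \<Rightarrow> (real \<times> real) measure" where
  "gamma_exp_pair m \<equiv> density lborel (\<lambda>y. ennreal (erlang_density (m - 2) (real m) y))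
        \<Otimes>\<^sub>M density lborel (\<lambda>z. ennreal (exponential_density 1 z))"

lemma pair_prob_space_gamma_exp:
  assumes "0 < m"
  shows "pair_prob_space (density lborel (\<lambda>y. ennreal (erlang_density (m - 2) (real m) y)))
    (density lborel (\<lambda>z. ennreal (exponential_density 1 z)))"
proof -
  interpret A: prob_space "density lborel (\<lambda>y. ennreal (erlang_density (m - 2) (real m) y))"
    using assms by (intro prob_space_erlang_density) simp
  interpret B: prob_space "density lborel (\<lambda>z. ennreal (exponential_density 1 z))"
    by (intro prob_space_erlang_density) simp
  show ?thesis ..
qed

lemma prob_space_gamma_exp: "0 < m \<Longrightarrow> prob_space (gamma_exp_pair m)"
  using pair_prob_space.axioms(1)[OF pair_prob_space_gamma_exp] pair_prob_space_gamma_exp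
  by (metis pair_prob_space.axioms(2,3) prob_space_pair)

text \<open>Both densities vanish on the negative half-line, and the point 0 is null.\<close>

lemma AE_gamma_exp_pos:
  assumes "0 < m"
  shows "AE w in gamma_exp_pair m. 0 < fst w \<and> 0 < snd w"
proof -
  have pos: "AE y in density lborel (\<lambda>y. ennreal (erlang_density k l y)). 0 < y" for k l
  proof -
    have "AE y in lborel. (y :: real) \<noteq> 0" by (rule AE_lborel_singleton)
    then show ?thesis
      by (subst AE_density) (auto simp: erlang_density_def elim!: eventually_mono)
  qed
  interpret pair_prob_space "density lborel (\<lambda>y. ennreal (erlang_density (m - 2) (real m) y))"
      "density lborel (\<lambda>z. ennreal (exponential_density 1 z))"
    by (rule pair_prob_space_gamma_exp[OF assms])
  show ?thesis
  proof (rule AE_pair_measure)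
    show "AE y in density lborel (\<lambda>y. ennreal (erlang_density (m - 2) (real m) y)).
        AE z in density lborel (\<lambda>z. ennreal (exponential_density 1 z)). 0 < fst (y, z) \<and> 0 < snd (y, z)"
      using pos[of "m - 2" m] by eventually_elim (use pos[of 0 1] in simp)
  qed measurable
qed

lemma real_distribution_T_dist:
  assumes "1 < m"
  shows "real_distribution (T_dist m)"
proof -
  interpret prob_space "gamma_exp_pair m"
    using assms by (intro prob_space_gamma_exp) simp
  have "prob_space (T_dist m)"
    unfolding T_dist_def by (rule prob_space_distr) measurable
  then show ?thesis
    by (intro real_distribution.intro real_distribution_axioms.intro) (simp_all add: T_dist_def)
qed

text \<open>ln r \<le> r - 1 at r = y m / (m + 1) bounds the part depending on y by its value at (m
  + 1) / m; positive z makes the bound strict.\<close>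

lemma AE_T_dist_less:
  assumes "1 < m"
  shows "AE t in T_dist m. t < real (m + 1) * ln (real (m + 1) / real m) - real (m + 1)"
proof -
  have *: "real (m + 1) * ln y - real m * y - z < real (m + 1) * ln (real (m + 1) / real m) - real (m + 1)"
    if "0 < y" "0 < z" for y z
  proof -
    have "ln (y * (real m / real (m + 1))) \<le> y * (real m / real (m + 1)) - 1"
      using that assms by (intro ln_le_minus_one) simp
    moreover have "ln (y * (real m / real (m + 1))) = ln y - ln (real (m + 1) / real m)"
      using that assms by (simp add: ln_mult ln_div)
    ultimately have "real (m + 1) * (ln y - ln (real (m + 1) / real m))
        \<le> real (m + 1) * (y * (real m / real (m + 1)) - 1)"
      by (intro mult_left_mono) auto
    also have "\<dots> = real m * y - real (m + 1)" by (simp add: field_simps)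
    finally show ?thesis using that by (simp add: algebra_simps)
  qed
  have "AE w in gamma_exp_pair m. 0 < fst w \<and> 0 < snd w"
    using assms by (intro AE_gamma_exp_pos) simp
  then have "AE w in gamma_exp_pair m. (case w of (y, z) \<Rightarrow> real (m + 1) * ln y - real m * y - z)
      < real (m + 1) * ln (real (m + 1) / real m) - real (m + 1)"
    by eventually_elim (use * in auto)
  then show ?thesis
    unfolding T_dist_def by (subst AE_distr_iff) measurable
qed

text \<open>This supplies the assumption on \<open>c\<close> in the locale
  \<open>exp_conf\<close>.\<close>

lemma cp_less:
  assumes "1 < m" "0 < p" "p < 1"
  shows "cp m p < real (m + 1) * ln (real (m + 1) / real m) - real (m + 1)"
  unfolding cp_def
  by (rule real_distribution.measure_atLeast_quantile(2)[OF real_distribution_T_dist[OF assms(1)]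
        assms(2,3) AE_T_dist_less[OF assms(1)]])

lemma T_dist_ge_cp:
  assumes "1 < m" "0 < p" "p < 1"
  shows "1 - p \<le> measure (T_dist m) {cp m p..}"
  unfolding cp_def
  by (rule real_distribution.measure_atLeast_quantile(1)[OF real_distribution_T_dist[OF assms(1)] assms(2,3)])

section \<open>Measurability of the coverage event\<close>

text \<open>The point is the limit 0, where 0 * ln 0 is 0. There the product is squeezed between - 2
  * sqrt z and z * (z - 1), both from ln r \<le> r - 1, at r = 1 / sqrt z and r = z.\<close>

lemma tendsto_mult_ln_self:
  fixes x :: "nat \<Rightarrow> real"
  assumes x: "\<And>k. 0 < x k" and lim: "x \<longlonglongrightarrow> l"
  shows "(\<lambda>k. x k * ln (x k)) \<longlonglongrightarrow> l * ln l"
proof (cases "l = 0")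
  case True
  have upper: "z * ln z \<le> z * (z - 1)" if "0 < z" for z :: real
    using that by (intro mult_left_mono ln_le_minus_one) auto
  have lower: "- (2 * sqrt z) \<le> z * ln z" if "0 < z" for z :: real
  proof -
    have "ln (inverse (sqrt z)) \<le> inverse (sqrt z) - 1"
      using that by (intro ln_le_minus_one) auto
    then have "- ln z \<le> 2 * inverse (sqrt z)"
      using that by (simp add: ln_inverse ln_sqrt)
    then have "z * - ln z \<le> z * (2 * inverse (sqrt z))"
      using that by (intro mult_left_mono) auto
    also have "\<dots> = 2 * sqrt z"
      using that by (simp add: field_simps)
    finally show ?thesis by simp
  qed
  have "(\<lambda>k. x k * ln (x k)) \<longlonglongrightarrow> 0"
  proof (rule tendsto_sandwich)
    show "(\<lambda>k. - (2 * sqrt (x k))) \<longlonglongrightarrow> 0"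
      using tendsto_minus[OF tendsto_mult_left[OF tendsto_real_sqrt[OF lim], of 2]] True by simp
    show "(\<lambda>k. x k * (x k - 1)) \<longlonglongrightarrow> 0"
      using tendsto_mult[OF lim tendsto_diff[OF lim tendsto_const, of 1]] True by simp
  qed (use x upper lower in auto)
  with True show ?thesis by simp
qed (intro tendsto_intros lim)

text \<open>Multiplying by \<sigma> gives a condition that stays continuous at \<sigma> = 0 and so
  survives passage to the limit.\<close>

lemma conf_region_nonzero_iff:
  assumes "s \<noteq> 0"
  shows "(\<mu>, \<sigma>) \<in> conf_region K M N c a s \<longleftrightarrow> \<mu> \<le> a \<and> 0 < \<sigma> \<and>
    N * (a - \<mu>) + M * s \<le> \<sigma> * (K * ln s - c) - K * (\<sigma> * ln \<sigma>)"
proof -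
  have "c \<le> K * ln (s / \<sigma>) - (N * (a - \<mu>) + M * s) / \<sigma> \<longleftrightarrow>
      N * (a - \<mu>) + M * s \<le> \<sigma> * (K * ln s - c) - K * (\<sigma> * ln \<sigma>)" if "0 < \<sigma>"
  proof -
    have "c \<le> K * ln (s / \<sigma>) - (N * (a - \<mu>) + M * s) / \<sigma>
      \<longleftrightarrow> (N * (a - \<mu>) + M * s) / \<sigma> \<le> K * (ln s - ln \<sigma>) - c"
      using that assms by (auto simp: ln_div)
    also have "\<dots> \<longleftrightarrow> N * (a - \<mu>) + M * s \<le> (K * (ln s - ln \<sigma>) - c) * \<sigma>"
      by (rule pos_divide_le_eq[OF that])
    finally show ?thesis by (simp add: algebra_simps)
  qed
  then show ?thesis by (auto simp: conf_region_def)
qed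

text \<open>For \<open>s < 0\<close> the region is not bounded away from \<open>\<sigma> = 0\<close> (\<open>ln\<close> is even), so
  a limit point of the parameters may lie on that boundary.\<close>

lemma conf_band_limit:
  assumes K: "0 < K" and M: "0 < M" and N: "0 < N" and s: "s \<noteq> 0" and \<sigma>: "0 < \<sigma>"
    and t: "t \<longlonglongrightarrow> l"
    and band: "\<And>k. (t k, expF \<mu> \<sigma> (t k)) \<in> conf_band K M N c a s"
  shows "(l, expF \<mu> \<sigma> l) \<in> conf_band K M N c a s"
proof -
  define b where "b = K * ln s - c"
  note iff = conf_region_nonzero_iff[OF s, of _ _ K M N c a, folded b_def]
  define L where "L u = max 0 ((u - \<mu>) / \<sigma>)" for u
  have "\<forall>k. \<exists>\<theta>. \<theta> \<in> conf_region K M N c a s \<and> expF \<mu> \<sigma> (t k) = expF (fst \<theta>) (snd \<theta>) (t k)"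
    using band unfolding conf_band_iff by fastforce
  then obtain \<theta> where \<theta>: "\<And>k. \<theta> k \<in> conf_region K M N c a s"
      and \<theta>eq: "\<And>k. expF \<mu> \<sigma> (t k) = expF (fst (\<theta> k)) (snd (\<theta> k)) (t k)"
    by metis
  have mu: "fst (\<theta> k) \<le> a" and sg: "0 < snd (\<theta> k)"
    and cond: "N * (a - fst (\<theta> k)) + M * s \<le> snd (\<theta> k) * b - K * (snd (\<theta> k) * ln (snd (\<theta> k)))" for k
    using \<theta>[of k] iff[of "fst (\<theta> k)" "snd (\<theta> k)"] by auto
  have lev: "max 0 ((t k - fst (\<theta> k)) / snd (\<theta> k)) = L (t k)" for k
    using \<theta>eq[of k] unfolding expF_alt[OF \<sigma>] expF_alt[OF sg] L_def by simp
  \<comment> \<open>Beyond \<open>B\<close> the term - K * \<sigma> * ln \<sigma> would push the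
    right side of \<open>cond\<close> below M * s, while the left side is at least M * s.\<close>
  define B where "B = max 1 (exp ((b + M * \<bar>s\<bar>) / K))"
  have sgB: "snd (\<theta> k) \<le> B" for k
  proof (rule ccontr)
    let ?z = "snd (\<theta> k)"
    assume "\<not> ?z \<le> B"
    then have z: "1 < ?z" "exp ((b + M * \<bar>s\<bar>) / K) < ?z" by (auto simp: B_def)
    then have "(b + M * \<bar>s\<bar>) / K < ln ?z" using sg ln_less_cancel_iff[of "exp ((b + M * \<bar>s\<bar>) / K)" ?z] by simp
    then have "b - K * ln ?z \<le> - (M * \<bar>s\<bar>)" using K by (simp add: field_simps)
    then have "?z * (b - K * ln ?z) \<le> ?z * - (M * \<bar>s\<bar>)"
      using sg[of k] by (intro mult_left_mono) auto
    also have "\<dots> < 1 * - (M * \<bar>s\<bar>)"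
      using z M s by (intro mult_strict_right_mono_neg) auto
    also have "\<dots> \<le> M * s" using M by (simp add: abs_if)
    finally have "?z * (b - K * ln ?z) < M * s" .
    moreover have "0 \<le> N * (a - fst (\<theta> k))" using N mu by simp
    ultimately show False using cond[of k] by (simp add: algebra_simps)
  qed
  \<comment> \<open>The locations are bounded below as well, since - z * ln z \<le> 1 for all z >
    0.\<close>
  have muB: "a - (B * \<bar>b\<bar> + K + M * \<bar>s\<bar>) / N \<le> fst (\<theta> k)" for k
  proof -
    let ?z = "snd (\<theta> k)"
    have "ln (inverse ?z) \<le> inverse ?z - 1" using sg by (intro ln_le_minus_one) simp
    then have "?z * - ln ?z \<le> ?z * (inverse ?z - 1)"
      using sg[of k] by (intro mult_left_mono) (auto simp: ln_inverse)
    also have "\<dots> \<le> 1" using sg[of k] by (simp add: right_diff_distrib)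
    finally have "K * (?z * - ln ?z) \<le> K * 1" using K by (intro mult_left_mono) auto
    moreover have "?z * b \<le> B * \<bar>b\<bar>"
    proof -
      have "?z * b \<le> ?z * \<bar>b\<bar>" using sg[of k] by (intro mult_left_mono) auto
      also have "\<dots> \<le> B * \<bar>b\<bar>" using sgB[of k] by (intro mult_right_mono) auto
      finally show ?thesis .
    qed
    moreover have "- (M * s) \<le> M * \<bar>s\<bar>" using M by (simp add: abs_if)
    ultimately have "N * (a - fst (\<theta> k)) \<le> B * \<bar>b\<bar> + K + M * \<bar>s\<bar>"
      using cond[of k] by simp
    then show ?thesis using N by (simp add: field_simps)
  qed
  have "bounded (range \<theta>)"
  proof (rule bounded_subset)
    show "bounded ({a - (B * \<bar>b\<bar> + K + M * \<bar>s\<bar>) / N..a} \<times> {0..B})"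
      by (intro bounded_Times bounded_closed_interval)
    show "range \<theta> \<subseteq> {a - (B * \<bar>b\<bar> + K + M * \<bar>s\<bar>) / N..a} \<times> {0..B}"
      by (intro image_subsetI) (simp add: mem_Times_iff mu sgB muB sg less_imp_le)
  qed
  then obtain \<theta>' r where r: "strict_mono r" and lim: "(\<theta> \<circ> r) \<longlonglongrightarrow> \<theta>'"
    using bounded_imp_convergent_subsequence by blast
  obtain \<mu>' \<sigma>' where \<theta>': "\<theta>' = (\<mu>', \<sigma>')" by (cases \<theta>')
  define m where "m k = fst (\<theta> (r k))" for k
  define z where "z k = snd (\<theta> (r k))" for k
  define u where "u k = t (r k)" for k
  have m: "m \<longlonglongrightarrow> \<mu>'" and z: "z \<longlonglongrightarrow> \<sigma>'"
    using tendsto_fst[OF lim] tendsto_snd[OF lim] by (simp_all add: m_def[abs_def] z_def[abs_def] \<theta>' o_def)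
  have u: "u \<longlonglongrightarrow> l"
    using LIMSEQ_subseq_LIMSEQ[OF t r] by (simp add: u_def[abs_def] o_def)
  have zpos: "0 < z k" for k using sg by (simp add: z_def)
  have mz: "(m k, z k) \<in> conf_region K M N c a s" for k
    using \<theta>[of "r k"] by (simp add: m_def z_def)
  have lev': "max 0 ((u k - m k) / z k) = L (u k)" for k
    using lev[of "r k"] by (simp add: m_def z_def u_def)
  have L_lim: "(\<lambda>k. L (u k)) \<longlonglongrightarrow> L l"
    unfolding L_def using u \<sigma> by (intro tendsto_intros) auto
  have \<sigma>'0: "0 \<le> \<sigma>'" using z zpos by (intro LIMSEQ_le_const[OF z]) (auto intro: less_imp_le)
  have \<mu>'a: "\<mu>' \<le> a" using mu by (intro LIMSEQ_le_const2[OF m]) (auto simp: m_def)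
  have cond': "N * (a - \<mu>') + M * s \<le> \<sigma>' * b - K * (\<sigma>' * ln \<sigma>')"
  proof (rule LIMSEQ_le)
    show "(\<lambda>k. N * (a - m k) + M * s) \<longlonglongrightarrow> N * (a - \<mu>') + M * s"
      by (intro tendsto_intros m)
    show "(\<lambda>k. z k * b - K * (z k * ln (z k))) \<longlonglongrightarrow> \<sigma>' * b - K * (\<sigma>' * ln \<sigma>')"
      by (intro tendsto_intros z tendsto_mult_ln_self zpos)
    show "\<exists>n. \<forall>k\<ge>n. N * (a - m k) + M * s \<le> z k * b - K * (z k * ln (z k))"
      using cond by (auto simp: m_def z_def)
  qed
  have witness: "(l, expF \<mu> \<sigma> l) \<in> conf_band K M N c a s"
    if "(x, y) \<in> conf_region K M N c a s" "max 0 ((l - x) / y) = L l" for x y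
  proof -
    have "0 < y" using that by (simp add: conf_region_def)
    then have "expF \<mu> \<sigma> l = expF x y l"
      using that(2) by (simp add: expF_alt[OF \<sigma>] expF_alt[of y] L_def)
    with that(1) show ?thesis unfolding conf_band_iff by (intro bexI[of _ "(x, y)"]) auto
  qed
  show ?thesis
  proof (cases "0 < \<sigma>'")
    case True
    have "(\<lambda>k. max 0 ((u k - m k) / z k)) \<longlonglongrightarrow> max 0 ((l - \<mu>') / \<sigma>')"
      using True by (intro tendsto_intros u m z) auto
    then have "max 0 ((l - \<mu>') / \<sigma>') = L l"
      using L_lim unfolding lev' by (rule LIMSEQ_unique)
    moreover have "(\<mu>', \<sigma>') \<in> conf_region K M N c a s"
      using True \<mu>'a cond' by (simp add: iff)
    ultimately show ?thesis by (intro witness)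
  next
    case False
    then have 0: "\<sigma>' = 0" using \<sigma>'0 by simp
    \<comment> \<open>The scales tend to 0 while the standardized values converge, so in the limit l
      is at most the location.\<close>
    have "l - \<mu>' \<le> L l * \<sigma>'"
    proof (rule LIMSEQ_le)
      show "(\<lambda>k. u k - m k) \<longlonglongrightarrow> l - \<mu>'" by (intro tendsto_intros u m)
      show "(\<lambda>k. L (u k) * z k) \<longlonglongrightarrow> L l * \<sigma>'" by (intro tendsto_intros L_lim z)
      have "u k - m k \<le> L (u k) * z k" for k
      proof -
        have "(u k - m k) / z k \<le> L (u k)" unfolding lev'[symmetric] by simp
        then show ?thesis using zpos[of k] by (simp add: pos_divide_le_eq)
      qed
      then show "\<exists>n. \<forall>k\<ge>n. u k - m k \<le> L (u k) * z k" by blast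
    qed
    then have "l < \<mu>' \<or> l = \<mu>'" using 0 by auto
    then show ?thesis
    proof
      \<comment> \<open>The points eventually lie left of the locations, so the limiting
        standardized value is 0, and a single member of the sequence with location beyond
        \<open>d\<close> is a witness.\<close>
      assume less: "l < \<mu>'"
      define d where "d = (l + \<mu>') / 2"
      have d: "l < d" "d < \<mu>'" using less by (auto simp: d_def)
      have ev: "eventually (\<lambda>k. u k < d \<and> d < m k) sequentially"
        using order_tendstoD(2)[OF u d(1)] order_tendstoD(1)[OF m d(2)] by (rule eventually_conj)
      have "eventually (\<lambda>k. L (u k) = 0) sequentially"
        using ev
      proof eventually_elim
        case (elim k)
        then have "(u k - m k) / z k \<le> 0" using zpos[of k] by (intro divide_nonpos_pos) auto
        then show ?case using lev'[of k] by simp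
      qed
      then have "(\<lambda>k. L (u k)) \<longlonglongrightarrow> 0" by (rule tendsto_eventually)
      then have L_zero: "L l = 0" using L_lim LIMSEQ_unique by blast
      obtain k where "d < m k" using eventually_happens[OF ev] by auto
      then have "(l - m k) / z k \<le> 0" using d zpos[of k] by (intro divide_nonpos_pos) auto
      then show ?thesis using mz[of k] L_zero by (intro witness[of "m k" "z k"]) auto
    next
      assume l: "l = \<mu>'"
      \<comment> \<open>\<open>y\<close> solves y * b - K * (y * ln y) = N * L l * y. Location l - L
        l * y and scale y then give the standardized value \<open>L l\<close> at l, and the region
        inequality reduces to \<open>cond'\<close> at \<sigma>' = 0.\<close>
      define y where "y = exp ((b - N * L l) / K)"
      have y: "0 < y" by (simp add: y_def)
      have L_nonneg: "0 \<le> L l" by (simp add: L_def)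
      have "K * ln y = b - N * L l" using K by (simp add: y_def)
      then have b: "b = K * ln y + N * L l" by simp
      have "y * b - K * (y * ln y) = N * (L l * y)"
        unfolding b by (simp add: algebra_simps)
      moreover have "N * (a - l) + M * s \<le> 0" using cond' 0 l by simp
      ultimately have "N * (a - (l - L l * y)) + M * s \<le> y * b - K * (y * ln y)"
        by (simp add: algebra_simps)
      moreover have "l - L l * y \<le> a" using l \<mu>'a L_nonneg y by (smt (verit) mult_nonneg_nonneg)
      ultimately have "(l - L l * y, y) \<in> conf_region K M N c a s" using y by (simp add: iff)
      then show ?thesis using y L_nonneg by (intro witness) auto
    qed
  qed
qed

text \<open>For \<open>s\<close> = 0 the logarithm is \<open>ln 0\<close>, that is 0, so besides
  \<mu> \<le> a the condition sees only (a - \<mu>) / \<sigma>. The graph at t = a therefore decides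
  membership, once \<mu> \<le> a is known from the graph at t = \<mu>.\<close>

lemma graph_subset_conf_band_0_iff:
  assumes N: "0 < N" and \<sigma>: "0 < \<sigma>"
  shows "graph (expF \<mu> \<sigma>) \<subseteq> conf_band K M N c a 0 \<longleftrightarrow> (\<mu>, \<sigma>) \<in> conf_region K M N c a 0"
proof
  assume sub: "graph (expF \<mu> \<sigma>) \<subseteq> conf_band K M N c a 0"
  have pt: "\<exists>\<mu>' \<sigma>'. (\<mu>', \<sigma>') \<in> conf_region K M N c a 0 \<and>
      max 0 ((t - \<mu>) / \<sigma>) = max 0 ((t - \<mu>') / \<sigma>')" for t
  proof -
    have "(t, expF \<mu> \<sigma> t) \<in> conf_band K M N c a 0" using sub by (auto simp: graph_def)
    then obtain \<mu>' \<sigma>' where *: "(\<mu>', \<sigma>') \<in> conf_region K M N c a 0" "expF \<mu> \<sigma> t = expF \<mu>' \<sigma>' t"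
      unfolding conf_band_iff by auto
    then have "0 < \<sigma>'" by (simp add: conf_region_def)
    with * show ?thesis using \<sigma> by (auto simp: expF_alt)
  qed
  \<comment> \<open>At t = \<mu> the function is 0, whereas for \<mu> > a every curve of the band is
    positive there.\<close>
  have a: "\<mu> \<le> a"
  proof (rule ccontr)
    assume "\<not> \<mu> \<le> a"
    moreover obtain \<mu>' \<sigma>' where "(\<mu>', \<sigma>') \<in> conf_region K M N c a 0"
        "max 0 ((\<mu> - \<mu>) / \<sigma>) = max 0 ((\<mu> - \<mu>') / \<sigma>')"
      using pt by blast
    moreover from this have "0 < \<sigma>'" "\<mu>' \<le> a" by (auto simp: conf_region_def)
    ultimately have "0 < (\<mu> - \<mu>') / \<sigma>'" by simp
    with \<open>max 0 ((\<mu> - \<mu>) / \<sigma>) = max 0 ((\<mu> - \<mu>') / \<sigma>')\<close> show False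
      by (simp only: diff_self div_0 max.idem max_absorb2 less_imp_le)
  qed
  obtain \<mu>' \<sigma>' where *: "(\<mu>', \<sigma>') \<in> conf_region K M N c a 0"
      "max 0 ((a - \<mu>) / \<sigma>) = max 0 ((a - \<mu>') / \<sigma>')"
    using pt by blast
  then have "0 < \<sigma>'" "\<mu>' \<le> a" "c \<le> - (N * (a - \<mu>') / \<sigma>')" by (auto simp: conf_region_def)
  moreover from this have "(a - \<mu>) / \<sigma> = (a - \<mu>') / \<sigma>'" using *(2) a \<sigma> by simp
  ultimately show "(\<mu>, \<sigma>) \<in> conf_region K M N c a 0"
    using a \<sigma> by (simp add: conf_region_def flip: times_divide_eq_right)
qed (auto simp: conf_band_def)

text \<open>The existential over the parameters is a projection, which in general need not preserve
  Borel sets. Projections of compact sets are compact, and the sets \<open>D r\<close> exhaust the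
  relevant parameters.\<close>

lemma conf_band_section_measurable:
  fixes t y :: real
  shows "{(a, s). s \<noteq> 0 \<and> (t, y) \<in> conf_band K M N c a s} \<in> sets (borel :: (real \<times> real) measure)"
proof -
  define f where "f = (\<lambda>((a, s), (\<mu>, \<sigma>)). (K * ln (s / \<sigma>) - (N * (a - \<mu>) + M * s) / \<sigma>,
      1 - exp (- max 0 ((t - \<mu>) / \<sigma>))))"
  \<comment> \<open>The bounds by \<open>inverse r\<close> keep \<sigma> and \<open>s\<close> away
    from 0, so that \<open>f\<close> is continuous on \<open>D r\<close>.\<close>
  define D where "D r = {((a, s), (\<mu>, \<sigma>)). \<bar>a\<bar> \<le> r \<and> inverse r \<le> \<bar>s\<bar> \<and> \<bar>s\<bar> \<le> r \<and> a - r \<le> \<mu> \<and> \<mu> \<le> a \<and>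
      inverse r \<le> \<sigma> \<and> \<sigma> \<le> r}" for r :: real
  define S where "S r = fst ` (D r \<inter> f -` ({c..} \<times> {y}))" for r
  have "compact (S r)" if r: "0 < r" for r
  proof -
    have "closed (D r)"
      unfolding D_def case_prod_beta
      by (intro closed_Collect_conj closed_Collect_le continuous_intros)
    moreover have "D r \<subseteq> ({- r..r} \<times> {- r..r}) \<times> ({- (2 * r)..r} \<times> {inverse r..r})"
    proof -
      have "0 < inverse r" using r by simp
      then show ?thesis unfolding D_def by (auto simp: abs_le_iff)
    qed
    moreover have "continuous_on (D r) f"
    proof -
      have "0 < inverse r" using r by simp
      then show ?thesis
        unfolding f_def D_def case_prod_beta by (intro continuous_intros) auto
    qed
    ultimately have "closed (D r \<inter> f -` ({c..} \<times> {y}))"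
      by (intro continuous_closed_preimage closed_Times) auto
    moreover have "bounded (D r \<inter> f -` ({c..} \<times> {y}))"
      by (rule bounded_subset[of "({- r..r} \<times> {- r..r}) \<times> ({- (2 * r)..r} \<times> {inverse r..r})"])
        (use \<open>D r \<subseteq> _\<close> in \<open>auto intro!: bounded_Times bounded_closed_interval\<close>)
    ultimately show ?thesis
      unfolding S_def by (intro compact_continuous_image continuous_intros) (simp add: compact_eq_bounded_closed)
  qed
  then have "(\<Union>i. S (real (Suc i))) \<in> sets borel"
    by (intro sets.countable_UN) (auto intro!: borel_compact)
  moreover have "(\<Union>i. S (real (Suc i))) = {(a, s). s \<noteq> 0 \<and> (t, y) \<in> conf_band K M N c a s}"
  proof (intro set_eqI iffI; clarify)
    fix a s :: real and i assume "(a, s) \<in> S (real (Suc i))"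
    then obtain \<mu> \<sigma> where *: "((a, s), (\<mu>, \<sigma>)) \<in> D (real (Suc i))" "f ((a, s), (\<mu>, \<sigma>)) \<in> {c..} \<times> {y}"
      by (auto simp: S_def)
    define r where "r = inverse (real (Suc i))"
    have "0 < r" by (simp add: r_def)
    moreover have "r \<le> \<sigma>" "r \<le> \<bar>s\<bar>" "\<mu> \<le> a" using *(1) unfolding D_def r_def by auto
    ultimately have "0 < \<sigma>" "s \<noteq> 0" "\<mu> \<le> a" by auto
    moreover from this have "(\<mu>, \<sigma>) \<in> conf_region K M N c a s" "y = expF \<mu> \<sigma> t"
      using *(2) by (auto simp: f_def conf_region_def expF_alt)
    ultimately show "s \<noteq> 0 \<and> (t, y) \<in> conf_band K M N c a s"
      unfolding conf_band_iff by auto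
  next
    fix a s assume s: "s \<noteq> 0" and "(t, y) \<in> conf_band K M N c a s"
    then obtain \<mu> \<sigma> where \<theta>: "(\<mu>, \<sigma>) \<in> conf_region K M N c a s" "y = expF \<mu> \<sigma> t"
      unfolding conf_band_iff by auto
    then have \<sigma>: "0 < \<sigma>" "\<mu> \<le> a" by (auto simp: conf_region_def)
    \<comment> \<open>A sum of nonnegative terms dominates each of them, so a positive integer above
      \<open>B\<close> serves as radius.\<close>
    define B where "B = \<bar>a\<bar> + inverse \<bar>s\<bar> + \<bar>s\<bar> + (a - \<mu>) + inverse \<sigma> + \<sigma>"
    obtain i where "B \<le> real i" using real_arch_simple by blast
    then have i: "B \<le> real (Suc i)" by simp
    have "\<bar>a\<bar> \<le> B" "inverse \<bar>s\<bar> \<le> B" "\<bar>s\<bar> \<le> B" "a - \<mu> \<le> B" "inverse \<sigma> \<le> B" "\<sigma> \<le> B"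
      using \<sigma> inverse_nonnegative_iff_nonnegative[of \<sigma>] inverse_nonnegative_iff_nonnegative[of "\<bar>s\<bar>"]
      unfolding B_def by linarith+
    then have j: "\<bar>a\<bar> \<le> real (Suc i)" "inverse \<bar>s\<bar> \<le> real (Suc i)" "\<bar>s\<bar> \<le> real (Suc i)"
        "a - \<mu> \<le> real (Suc i)" "inverse \<sigma> \<le> real (Suc i)" "\<sigma> \<le> real (Suc i)"
      using i by linarith+
    have "inverse (real (Suc i)) \<le> \<bar>s\<bar>" "inverse (real (Suc i)) \<le> \<sigma>"
      using le_imp_inverse_le[OF j(2)] le_imp_inverse_le[OF j(5)] s \<sigma> by auto
    then have "((a, s), (\<mu>, \<sigma>)) \<in> D (real (Suc i))"
      using j \<sigma> unfolding D_def by simp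
    moreover have "f ((a, s), (\<mu>, \<sigma>)) \<in> {c..} \<times> {y}"
      using \<theta> \<sigma> by (simp add: f_def conf_region_def expF_alt)
    ultimately show "(a, s) \<in> (\<Union>i. S (real (Suc i)))"
      unfolding S_def by force
  qed
  ultimately show ?thesis by simp
qed

text \<open>Closedness along sequences (\<open>conf_band_limit\<close>) reduces the quantifier over
  t to rational t off the line \<open>s\<close> = 0; on that line the region alone describes the
  event.\<close>

lemma graph_subset_conf_band_measurable:
  assumes "0 < K" and "0 < M" and N: "0 < N" and \<sigma>: "0 < \<sigma>"
  shows "{(a, s). graph (expF \<mu> \<sigma>) \<subseteq> conf_band K M N c a s} \<in> sets (borel :: (real \<times> real) measure)"
proof -
  have rat: "graph (expF \<mu> \<sigma>) \<subseteq> conf_band K M N c a s \<longleftrightarrow>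
      (\<forall>q\<in>\<rat>. (q, expF \<mu> \<sigma> q) \<in> conf_band K M N c a s)" if s: "s \<noteq> 0" for a s
  proof
    assume q: "\<forall>q\<in>\<rat>. (q, expF \<mu> \<sigma> q) \<in> conf_band K M N c a s"
    have "(t, expF \<mu> \<sigma> t) \<in> conf_band K M N c a s" for t
    proof -
      have "t \<in> closure \<rat>" by (simp add: Rats_closure_real)
      then obtain x where x: "\<And>k. x k \<in> \<rat>" "x \<longlonglongrightarrow> t" unfolding closure_sequential by blast
      show ?thesis by (rule conf_band_limit[OF assms(1-3) s \<sigma> x(2)]) (use q x(1) in blast)
    qed
    then show "graph (expF \<mu> \<sigma>) \<subseteq> conf_band K M N c a s" by (auto simp: graph_def)
  qed (auto simp: graph_def)
  have "{(a, s). graph (expF \<mu> \<sigma>) \<subseteq> conf_band K M N c a s}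
    = {(a, s). s = 0 \<and> (\<mu>, \<sigma>) \<in> conf_region K M N c a s} \<union>
      (\<Inter>q\<in>\<rat>. {(a, s). s \<noteq> 0 \<and> (q, expF \<mu> \<sigma> q) \<in> conf_band K M N c a s})"
    (is "?A = ?B \<union> ?C")
  proof (intro set_eqI, clarify)
    fix a s
    show "(a, s) \<in> ?A \<longleftrightarrow> (a, s) \<in> ?B \<union> ?C"
    proof (cases "s = 0")
      \<comment> \<open>The intersection excludes \<open>s\<close> = 0 because its index set is
        nonempty.\<close>
      case True
      then show ?thesis
        using graph_subset_conf_band_0_iff[OF N \<sigma>, of \<mu> K M c a] by (auto intro: bexI[OF _ Rats_0])
    next
      case False
      then show ?thesis using rat[of s a] by simp
    qed
  qed
  moreover have "{(a, s). s = 0 \<and> (\<mu>, \<sigma>) \<in> conf_region K M N c a s} \<in> sets borel"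
  proof -
    have "{x \<in> space (borel \<Otimes>\<^sub>M borel). snd x = 0 \<and> \<mu> \<le> fst x \<and>
        c \<le> K * ln (snd x / \<sigma>) - (N * (fst x - \<mu>) + M * snd x) / \<sigma>} \<in> sets (borel \<Otimes>\<^sub>M borel)"
      by measurable
    moreover have "{(a, s). s = 0 \<and> (\<mu>, \<sigma>) \<in> conf_region K M N c a s}
      = {x \<in> space (borel \<Otimes>\<^sub>M borel). snd x = 0 \<and> \<mu> \<le> fst x \<and>
        c \<le> K * ln (snd x / \<sigma>) - (N * (fst x - \<mu>) + M * snd x) / \<sigma>}"
      using \<sigma> unfolding conf_region_def space_pair_measure by fastforce
    ultimately show ?thesis by (simp only: borel_prod)
  qed
  moreover have "(\<Inter>q\<in>\<rat>. {(a, s). s \<noteq> 0 \<and> (q, expF \<mu> \<sigma> q) \<in> conf_band K M N c a s}) \<in> sets borel"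
    by (intro sets.countable_INT'' conf_band_section_measurable countable_rat) auto
  ultimately show ?thesis by simp
qed

section \<open>Level of the region and the band\<close>

lemma pc_measure_law_pair:
  fixes h :: "real \<times> real \<Rightarrow> ennreal"
  assumes m: "1 < m" and \<sigma>: "0 < \<sigma>" and h: "h \<in> borel_measurable borel"
  shows "(\<integral>\<^sup>+x. h (x 1, sigmahat m R x) \<partial>pc_measure m R \<mu> \<sigma>)
    = (\<integral>\<^sup>+w. h (\<mu> + \<sigma> / gam m R 1 * snd w, \<sigma> * fst w) \<partial>gamma_exp_pair m)"
proof -
  interpret pair_prob_space "density lborel (\<lambda>y. ennreal (erlang_density (m - 2) (real m) y))"
      "density lborel (\<lambda>z. ennreal (exponential_density 1 z))"
    using m by (intro pair_prob_space_gamma_exp) simp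
  have [measurable]: "h \<in> borel_measurable (borel \<Otimes>\<^sub>M borel)"
    using h by (simp add: borel_prod)
  have "(\<integral>\<^sup>+w. h (\<mu> + \<sigma> / gam m R 1 * snd w, \<sigma> * fst w) \<partial>gamma_exp_pair m)
    = (\<integral>\<^sup>+z. (\<integral>\<^sup>+y. h (\<mu> + \<sigma> / gam m R 1 * z, \<sigma> * y)
         \<partial>density lborel (\<lambda>y. ennreal (erlang_density (m - 2) (real m) y)))
       \<partial>density lborel (\<lambda>z. ennreal (exponential_density 1 z)))"
    by (subst nn_integral_snd[symmetric]) simp_all
  also have "\<dots> = (\<integral>\<^sup>+z. ennreal (exponential_density 1 z) * (\<integral>\<^sup>+y. ennreal (erlang_density (m - 2) (real m) y) *
      h (\<mu> + \<sigma> / gam m R 1 * z, \<sigma> * y) \<partial>lborel) \<partial>lborel)"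
    by (simp add: nn_integral_density)
  also have "\<dots> = (\<integral>\<^sup>+z. \<integral>\<^sup>+y. h (\<mu> + \<sigma> / gam m R 1 * z, \<sigma> * y) * ennreal (erlang_density (m - 2) m y) *
         ennreal (exponential_density 1 z) \<partial>lborel \<partial>lborel)"
    by (subst nn_integral_cmult[symmetric]) (simp_all add: mult_ac)
  finally show ?thesis
    unfolding pc_measure_law[OF m \<sigma> h] by simp
qed

lemma estimators_measurable:
  assumes "1 < m"
  shows "(\<lambda>x. (x 1, sigmahat m R x)) \<in> pc_measure m R \<mu> \<sigma> \<rightarrow>\<^sub>M borel"
proof -
  have "(\<lambda>x. (x 1, sigmahat m R x)) \<in> PiM {1..m} (\<lambda>_. lborel) \<rightarrow>\<^sub>M borel \<Otimes>\<^sub>M borel"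
    using assms by (intro measurable_Pair sigmahat_measurable measurable_PiM_component_lborel) auto
  then show ?thesis by (simp add: pc_measure_def borel_prod)
qed

text \<open>Specialization of the law of the estimators to indicators.\<close>

lemma emeasure_pc_measure:
  fixes S :: "(real \<times> real) set"
  assumes m: "1 < m" and \<sigma>: "0 < \<sigma>" and S: "S \<in> sets borel"
  shows "emeasure (pc_measure m R \<mu> \<sigma>) {x \<in> space (pc_measure m R \<mu> \<sigma>). (x 1, sigmahat m R x) \<in> S}
    = emeasure (gamma_exp_pair m)
        {w \<in> space (gamma_exp_pair m). (\<mu> + \<sigma> / gam m R 1 * snd w, \<sigma> * fst w) \<in> S}"
proof -
  have ind: "indicator S \<in> borel_measurable borel" using S by simp
  have 1: "(\<lambda>w. (\<mu> + \<sigma> / gam m R 1 * snd w, \<sigma> * fst w)) \<in> gamma_exp_pair m \<rightarrow>\<^sub>M borel"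
    unfolding borel_prod[symmetric] by measurable
  have eq: "emeasure M {x \<in> space M. f x \<in> S} = (\<integral>\<^sup>+x. indicator S (f x) \<partial>M)"
    if "f \<in> M \<rightarrow>\<^sub>M borel" for M and f :: "'z \<Rightarrow> real \<times> real"
  proof -
    have "{x \<in> space M. f x \<in> S} \<in> sets M" using that S by measurable
    then have "emeasure M {x \<in> space M. f x \<in> S} = (\<integral>\<^sup>+x. indicator {x \<in> space M. f x \<in> S} x \<partial>M)" by simp
    also have "\<dots> = (\<integral>\<^sup>+x. indicator S (f x) \<partial>M)"
      by (intro nn_integral_cong) (simp add: indicator_def)
    finally show ?thesis .
  qed
  show ?thesis
    unfolding eq[OF estimators_measurable[OF m]] eq[OF 1] by (rule pc_measure_law_pair[OF m \<sigma> ind])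
qed

text \<open>With S = UNIV the law of the estimators transfers the total mass 1 from the gamma and
  exponential pair.\<close>

lemma prob_space_pc_measure:
  assumes "1 < m" "0 < \<sigma>"
  shows "prob_space (pc_measure m R \<mu> \<sigma>)"
proof
  interpret prob_space "gamma_exp_pair m"
    using assms by (intro prob_space_gamma_exp) simp
  show "emeasure (pc_measure m R \<mu> \<sigma>) (space (pc_measure m R \<mu> \<sigma>)) = 1"
    using emeasure_pc_measure[OF assms, of UNIV R \<mu>] emeasure_space_1 by simp
qed

text \<open>Under the law of the estimators a nonpositive estimate corresponds to \<sigma> Y \<le>
  0, a null event.\<close>

lemma AE_sigmahat_pos:
  assumes "1 < m" "0 < \<sigma>"
  shows "AE x in pc_measure m R \<mu> \<sigma>. 0 < sigmahat m R x"
proof -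
  interpret G: prob_space "gamma_exp_pair m"
    using assms by (intro prob_space_gamma_exp) simp
  let ?S = "UNIV \<times> {..0} :: (real \<times> real) set"
  have S: "?S \<in> sets borel" by (intro borel_closed closed_Times) auto
  have "AE w in gamma_exp_pair m. 0 < fst w \<and> 0 < snd w"
    using assms by (intro AE_gamma_exp_pos) simp
  then have "AE w in gamma_exp_pair m. \<not> (\<mu> + \<sigma> / gam m R 1 * snd w, \<sigma> * fst w) \<in> ?S"
    by eventually_elim (use assms in \<open>auto simp: mult_le_0_iff\<close>)
  then have "emeasure (gamma_exp_pair m)
        {w \<in> space (gamma_exp_pair m). (\<mu> + \<sigma> / gam m R 1 * snd w, \<sigma> * fst w) \<in> ?S} = 0"
    by (rule emeasure_eq_0_AE)
  then have "emeasure (pc_measure m R \<mu> \<sigma>) {x \<in> space (pc_measure m R \<mu> \<sigma>). (x 1, sigmahat m R x) \<in> ?S} = 0"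
    unfolding emeasure_pc_measure[OF assms S] .
  moreover have "{x \<in> space (pc_measure m R \<mu> \<sigma>). (x 1, sigmahat m R x) \<in> ?S} \<in> sets (pc_measure m R \<mu> \<sigma>)"
    using measurable_sets[OF estimators_measurable[OF assms(1)] S] by (simp add: vimage_def Int_def conj_commute)
  ultimately show ?thesis
    by (intro AE_I[where N = "{x \<in> space (pc_measure m R \<mu> \<sigma>). (x 1, sigmahat m R x) \<in> ?S}"]) auto
qed

section \<open>Return to the sets and functions of the statement\<close>

lemma C3_eq:
  "C3 n m R p x = conf_region (real (m + 1)) (real m) (real n) (cp m p) (x 1) (sigmahat m R x)"
  by (simp add: C3_def conf_region_def muhat_def)

lemma B3_eq:
  "B3 n m R p x = conf_band (real (m + 1)) (real m) (real n) (cp m p) (x 1) (sigmahat m R x)"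
  by (simp only: B3_def conf_band_def C3_eq)

lemma B3_eq_band:
  assumes "1 < m" "m \<le> n" "0 < p" "p < 1" and s: "0 < sigmahat m R x"
  shows "B3 n m R p x = {(t, y). 0 \<le> y \<and> y \<le> 1 \<and> U3 m R p x t \<le> y \<and> y \<le> O3 n m R p x t}"
proof -
  interpret exp_conf "real (m + 1)" "real m" "real n" "cp m p" "x 1" "sigmahat m R x"
    using assms cp_less by unfold_locales auto
  have L: "Z0 m R p x = L0" "Zm1 m R p x = Lm1"
    unfolding Z0_def Zm1_def L0_def Lm1_def y0_def by simp_all
  have star: "sigstar n m R x t = star t" for t
    by (simp only: sigstar_def star_def muhat_def)
  have g: "gfun n m R p x z = gf z" for z
    by (simp only: gfun_def gf_def)
  have U: "U3 m R p x t = expF (x 1) L0 t" for t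
    by (simp only: U3_def L muhat_def)
  \<comment> \<open>In the outer cases \<open>gf\<close> vanishes at \<open>opt t\<close>, so the
    location is the estimate itself.\<close>
  have O: "O3 n m R p x t = expF (x 1 + gf (opt t)) (opt t) t" for t
    unfolding O3_def L star g opt_def Let_def muhat_def using gf_L by auto
  have range: "0 \<le> expF \<mu> \<sigma> t \<and> expF \<mu> \<sigma> t \<le> 1" if "0 < \<sigma>" for \<mu> \<sigma> t
    using that by (simp add: expF_alt)
  have "0 \<le> U3 m R p x t" "O3 n m R p x t \<le> 1" for t
    unfolding U O using range L_pos opt_bounds by auto
  note bounds = this
  show ?thesis
  proof (intro set_eqI, clarify)
    fix t y
    show "(t, y) \<in> B3 n m R p x \<longleftrightarrow>
        (t, y) \<in> {(t, y). 0 \<le> y \<and> y \<le> 1 \<and> U3 m R p x t \<le> y \<and> y \<le> O3 n m R p x t}"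
      unfolding B3_eq conf_band_eq U[symmetric] O[symmetric]
      using bounds[of t] by (auto intro: order_trans)
  qed
qed

text \<open>Inserting the representation of the estimators cancels \<mu> and \<sigma> and turns the
  region's inequality into the pivot being at least \<open>cp m p\<close>; \<mu> \<le> muhat holds
  since Z is positive.\<close>

lemma C3_level:
  assumes "1 < m" "m \<le> n" and n: "(\<Sum>j=1..m. R j) = n - m" and "0 < p" "p < 1" and \<sigma>: "0 < \<sigma>"
  shows "1 - p \<le> measure (pc_measure m R \<mu> \<sigma>)
    {x \<in> space (pc_measure m R \<mu> \<sigma>). (\<mu>, \<sigma>) \<in> C3 n m R p x}"
proof -
  let ?T = "\<lambda>(y, z). real (m + 1) * ln y - real m * y - z"
  define S where "S = {as. (\<mu>, \<sigma>) \<in> conf_region (real (m + 1)) (real m) (real n) (cp m p) (fst as) (snd as)}"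
  \<comment> \<open>The censoring numbers sum to n - m, so the first weight is the full sample
    size.\<close>
  have gam1: "gam m R 1 = real n"
  proof -
    have "(\<Sum>i=1..m. R i + 1) = n" using n assms(2) by (simp only: sum.distrib) simp
    then show ?thesis by (simp only: gam_def)
  qed
  have n0: "0 < real n" using assms by simp
  have S: "S \<in> sets borel"
  proof -
    have "{as \<in> space (borel \<Otimes>\<^sub>M borel). \<mu> \<le> fst as \<and> cp m p \<le> real (m + 1) * ln (snd as / \<sigma>)
        - (real n * (fst as - \<mu>) + real m * snd as) / \<sigma>} \<in> sets (borel \<Otimes>\<^sub>M borel)"
      by measurable
    moreover have "S = {as \<in> space (borel \<Otimes>\<^sub>M borel). \<mu> \<le> fst as \<and> cp m p \<le> real (m + 1) * ln (snd as / \<sigma>)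
        - (real n * (fst as - \<mu>) + real m * snd as) / \<sigma>}"
      using \<sigma> by (simp add: S_def conf_region_def space_pair_measure)
    ultimately show ?thesis by (simp only: borel_prod)
  qed
  have "1 - p \<le> measure (T_dist m) {cp m p..}"
    using assms by (intro T_dist_ge_cp)
  also have "\<dots> = measure (gamma_exp_pair m) {w \<in> space (gamma_exp_pair m). cp m p \<le> ?T w}"
    unfolding T_dist_def by (subst measure_distr) (auto intro!: arg_cong2[where f = measure])
  also have "\<dots> = measure (gamma_exp_pair m)
      {w \<in> space (gamma_exp_pair m). (\<mu> + \<sigma> / gam m R 1 * snd w, \<sigma> * fst w) \<in> S}"
  proof (intro measure_eq_AE)
    have "AE w in gamma_exp_pair m. 0 < fst w \<and> 0 < snd w"
      using assms by (intro AE_gamma_exp_pos) simp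
    then show "AE w in gamma_exp_pair m. w \<in> {w \<in> space (gamma_exp_pair m). cp m p \<le> ?T w} \<longleftrightarrow>
        w \<in> {w \<in> space (gamma_exp_pair m). (\<mu> + \<sigma> / gam m R 1 * snd w, \<sigma> * fst w) \<in> S}"
    proof eventually_elim
      case (elim w)
      have 1: "(real n * (\<mu> + \<sigma> / real n * snd w - \<mu>) + real m * (\<sigma> * fst w)) / \<sigma> = snd w + real m * fst w"
        using n0 \<sigma> by (simp add: field_simps)
      have 2: "\<sigma> * fst w / \<sigma> = fst w" using \<sigma> by simp
      have "0 \<le> \<sigma> / real n * snd w" using elim n0 \<sigma> by simp
      then have 3: "\<mu> \<le> \<mu> + \<sigma> / real n * snd w" by simp
      have "(\<mu> + \<sigma> / gam m R 1 * snd w, \<sigma> * fst w) \<in> S \<longleftrightarrow>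
          cp m p \<le> real (m + 1) * ln (fst w) - (snd w + real m * fst w)"
        unfolding S_def conf_region_def gam1 mem_Collect_eq fst_conv snd_conv prod.case 1 2
        using \<sigma> 3 by simp
      also have "\<dots> \<longleftrightarrow> cp m p \<le> ?T w"
        unfolding case_prod_beta by argo
      finally show ?case by simp
    qed
  next
    show "{w \<in> space (gamma_exp_pair m). cp m p \<le> ?T w} \<in> sets (gamma_exp_pair m)" by measurable
    have "(\<lambda>w. (\<mu> + \<sigma> / gam m R 1 * snd w, \<sigma> * fst w)) \<in> gamma_exp_pair m \<rightarrow>\<^sub>M borel"
      unfolding borel_prod[symmetric] by measurable
    then show "{w \<in> space (gamma_exp_pair m). (\<mu> + \<sigma> / gam m R 1 * snd w, \<sigma> * fst w) \<in> S} \<in> sets (gamma_exp_pair m)"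
      using S by measurable
  qed
  also have "\<dots> = measure (pc_measure m R \<mu> \<sigma>)
      {x \<in> space (pc_measure m R \<mu> \<sigma>). (x 1, sigmahat m R x) \<in> S}"
    unfolding measure_def emeasure_pc_measure[OF assms(1) \<sigma> S] ..
  finally show ?thesis by (simp add: S_def C3_eq)
qed

theorem theorem2:
  fixes n m :: nat and R :: "nat \<Rightarrow> nat" and p \<mu> \<sigma> :: real
  assumes "1 < m" and "m \<le> n" and "(\<Sum>j=1..m. R j) = n - m"
    and "0 < p" and "p < 1" and "0 < \<sigma>"
  shows "{x \<in> space (pc_measure m R \<mu> \<sigma>). graph (expF \<mu> \<sigma>) \<subseteq> B3 n m R p x}
           \<in> sets (pc_measure m R \<mu> \<sigma>)
    \<and> (AE x in pc_measure m R \<mu> \<sigma>. \<forall>t. is_interval {y. (t, y) \<in> B3 n m R p x})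
    \<and> measure (pc_measure m R \<mu> \<sigma>)
        {x \<in> space (pc_measure m R \<mu> \<sigma>). graph (expF \<mu> \<sigma>) \<subseteq> B3 n m R p x} \<ge> 1 - p
    \<and> (AE x in pc_measure m R \<mu> \<sigma>.
         B3 n m R p x = {(t, y). 0 \<le> y \<and> y \<le> 1 \<and> U3 m R p x t \<le> y \<and> y \<le> O3 n m R p x t})"
proof (intro conjI)
  let ?P = "pc_measure m R \<mu> \<sigma>"
  interpret prob_space ?P using assms by (intro prob_space_pc_measure)
  \<comment> \<open>The event depends on the sample only through the estimators, hence is the
    preimage of a Borel set of the plane.\<close>
  let ?S = "{(a, s). graph (expF \<mu> \<sigma>) \<subseteq> conf_band (real (m + 1)) (real m) (real n) (cp m p) a s}"
  have "?S \<in> sets borel"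
    using assms by (intro graph_subset_conf_band_measurable) auto
  from measurable_sets[OF estimators_measurable[OF assms(1)] this]
  show meas: "{x \<in> space ?P. graph (expF \<mu> \<sigma>) \<subseteq> B3 n m R p x} \<in> sets ?P"
    by (simp add: B3_eq vimage_def Int_def conj_commute)
  have "1 - p \<le> prob {x \<in> space ?P. (\<mu>, \<sigma>) \<in> C3 n m R p x}"
    using assms by (intro C3_level)
  \<comment> \<open>A region containing the true parameter yields a band containing its entire
    graph.\<close>
  also have "\<dots> \<le> prob {x \<in> space ?P. graph (expF \<mu> \<sigma>) \<subseteq> B3 n m R p x}"
    by (intro finite_measure_mono meas) (auto simp: B3_def)
  finally show "1 - p \<le> prob {x \<in> space ?P. graph (expF \<mu> \<sigma>) \<subseteq> B3 n m R p x}" .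
  have "AE x in ?P. 0 < sigmahat m R x"
    using assms by (intro AE_sigmahat_pos)
  then show band: "AE x in ?P. B3 n m R p x =
      {(t, y). 0 \<le> y \<and> y \<le> 1 \<and> U3 m R p x t \<le> y \<and> y \<le> O3 n m R p x t}"
    by eventually_elim (use assms in \<open>intro B3_eq_band\<close>)
  then show "AE x in ?P. \<forall>t. is_interval {y. (t, y) \<in> B3 n m R p x}"
  proof eventually_elim
    case (elim x)
    show ?case unfolding elim is_interval_1 by auto
  qed
qed

end
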